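(* Let $\pmb{p}=(p_1,p_2)\neq(0,0)$ be a bidegree and let $\mathcal{M}$ be an LR-mesh. At least $6$ minimal support B-splines are needed for a linear dependence relation: if $B^1,\dots,B^n$ ($n\ge 1$) are pairwise distinct elements of $\mathcal{B}^{\mathcal{MS}}(\mathcal{M})$ and there are real numbers $\alpha_1,\dots,\alpha_n$, all nonzero, with $\sum_{j=1}^n\alpha_jB^j=0$ on $\mathbb{R}^2$, then $n\ge 6$.
   Context: Meshes. Let $\Omega\subset\mathbb{R}^2$ be an axis-aligned rectangle. A box-partition $\mathcal{E}$ of $\Omega$ is a finite collection of axis-aligned rectangles (elements) with pairwise disjoint interiors and union $\Omega$. Its vertices are the vertices of its elements; a meshline is a segment (in the element boundaries) connecting two and only two vertices of $\mathcal{E}$; the collection $\mathcal{M}$ of meshlines is the box-mesh. Vertical meshlines are called 1-meshlines, horizontal ones 2-meshlines. Each meshline $\gamma$ carries an integer multiplicity $\mu(\gamma)\ge1$; for the fixed bidegree $\pmb{p}=(p_1,p_2)$ one assumes $\mu(\gamma)\le p_k+1$ for every $k$-meshline. An axis-aligned segment $\gamma$ traverses an element $\beta$ if $\beta\setminus\gamma$ is not connected. A split is a finite union of contiguous colinear segments, each of which either traverses an element or is a meshline of $\mathcal{M}$; vertical splits are 1-splits, horizontal splits are 2-splits. A split of $\mathcal{M}$ is a split made of meshlines of $\mathcal{M}$; it is maximal if it contains every meshline of $\mathcal{M}$ contiguous and colinear with it. $\mathcal{M}$ has constant splits if all meshlines in each maximal split have the same multiplicity; this defines $\mu(\gamma)$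 for a split $\gamma$ of $\mathcal{M}$. Inserting a split $\gamma$ with multiplicity $\mu_\gamma\ge1$ gives $\mathcal{M}+\gamma$: each element traversed by $\gamma$ is cut in two along $\gamma$; meshlines not in $\gamma$ keep their multiplicity, meshlines in $\gamma$ already in $\mathcal{M}$ have multiplicity increased by $\mu_\gamma$, and new meshlines in $\gamma$ get multiplicity $\mu_\gamma$. The length of a $k$-split is the number of orthogonal meshlines it intersects, counted with multiplicity (i.e. the sum, over the mesh vertices on it, of the maximal multiplicity of the orthogonal meshlines at that vertex). LR-mesh: a mesh $\mathcal{M}=\mathcal{M}_N$ obtained from a tensor product mesh $\mathcal{M}_1$ (the mesh of the elements $[\tau_{1,i},\tau_{1,i+1}]\times[\tau_{2,j},\tau_{2,j+1}]$ for two increasing sequences, with multiplicities and constant splits) by successive insertions $\mathcal{M}_{i+1}=\mathcal{M}_i+\gamma_i$, each $\mathcal{M}_{i+1}$ having constant splits. Standing assumptions: $\mathcal{M}_1$ has at least $p_1+2$ vertical and $p_2+2$ horizontal splits counted with multiplicity (LR-rule 1), and at every step every maximal $k$-split has length at least $p_{3-k}+2$, $k\in\{1,2\}$ (LR-rule 2). B-splines. For nondecreasing $\pmb{t}=(t_1,\dots,t_{p+2})$, $B[\pmb{t}]$ is the univariate degree $p$ B-spline given by $B[\pmb{t}](t)=\frac{t-t_1}{t_{p+1}-t_1}B[t_1,\dots,t_{p+1}](t)+\frac{t_{p+2}-t}{t_{p+2}-t_2}B[t_2,\dots,t_{p+2}](t)$ (fractions with zero denominator are $0$), with $B[t_i,t_{i+1}]$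 the indicator of $[t_i,t_{i+1})$. For $\pmb{x}=(x_1,\dots,x_{p_1+2})$, $\pmb{y}=(y_1,\dots,y_{p_2+2})$, $B[\pmb{x},\pmb{y}](x,y)=B[\pmb{x}](x)B[\pmb{y}](y)$, with support $[x_1,x_{p_1+2}]\times[y_1,y_{p_2+2}]$. The splits of $B[\pmb{x},\pmb{y}]$ are the segments $\{x_i\}\times[y_1,y_{p_2+2}]$ and $[x_1,x_{p_1+2}]\times\{y_j\}$, with multiplicity that of $x_i$ in $\pmb{x}$, resp. $y_j$ in $\pmb{y}$. A split $\gamma$ traverses $B[\pmb{x},\pmb{y}]$ if it divides the interior of the support into two parts. MS B-splines. $B[\pmb{x},\pmb{y}]$ has support in $\mathcal{M}$ if its support lies in $\Omega$ and every split of it of multiplicity $m$ is contained in a split $\gamma$ of $\mathcal{M}$ with $\mu(\gamma)\ge m$. It has minimal support in $\mathcal{M}$ (is an MS B-spline) if in addition, for every split $\gamma$ of $\mathcal{M}$ meeting the interior of its support, $\gamma$ traverses $B[\pmb{x},\pmb{y}]$ if and only if a split of $B[\pmb{x},\pmb{y}]$ of multiplicity $\mu(\gamma)$ is contained in $\gamma$. $\mathcal{B}^{\mathcal{MS}}(\mathcal{M})$ is the set of all MS B-splines of bidegree $\pmb{p}$ on $\mathcal{M}$. *)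

theory Defs
  imports "HOL-Analysis.Analysis"
begin

section \<open>Directions and axis-aligned segments\<close>

type_synonym point = "real \<times> real"

text \<open>Direction 1 is \<open>Vertical\<close>, direction 2 is \<open>Horizontal\<close>.\<close>

datatype dir = Vertical | Horizontal

fun orth :: "dir \<Rightarrow> dir" where
  "orth Vertical = Horizontal"
| "orth Horizontal = Vertical"

fun deg :: "nat \<times> nat \<Rightarrow> dir \<Rightarrow> nat" where
  "deg p Vertical = fst p"
| "deg p Horizontal = snd p"

fun axis_segment :: "dir \<Rightarrow> real \<Rightarrow> real \<Rightarrow> real \<Rightarrow> point set" where
  "axis_segment Vertical t a b = {t} \<times> {a..b}"
| "axis_segment Horizontal t a b = {a..b} \<times> {t}"

definition is_segment :: "dir \<Rightarrow> point set \<Rightarrow> bool" where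
  "is_segment k \<gamma> \<longleftrightarrow> (\<exists>t a b. a < b \<and> \<gamma> = axis_segment k t a b)"


section \<open>Box-partitions and box-meshes\<close>

definition is_rectangle :: "point set \<Rightarrow> bool" where
  "is_rectangle R \<longleftrightarrow> (\<exists>a b c d. a < b \<and> c < d \<and> R = {a..b} \<times> {c..d})"

definition corners :: "point set \<Rightarrow> point set" where
  "corners R = {v. \<exists>a b c d. a < b \<and> c < d \<and> R = {a..b} \<times> {c..d} \<and> v \<in> {a, b} \<times> {c, d}}"

definition box_partition :: "point set \<Rightarrow> point set set \<Rightarrow> bool" where
  "box_partition \<Omega> E \<longleftrightarrow>
     is_rectangle \<Omega> \<and> finite E \<and> (\<forall>\<beta>\<in>E. is_rectangle \<beta>) \<and>
     (\<forall>\<beta>\<in>E. \<forall>\<beta>'\<in>E. \<beta> \<noteq> \<beta>' \<longrightarrow> interior \<beta> \<inter> interior \<beta>' = {}) \<and>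
     \<Union>E = \<Omega>"

text \<open>
  The multiplicity function is only meaningful on the meshlines; its values on other sets are
  never used.
\<close>

record box_mesh =
  elements :: "point set set"
  mline_mult :: "point set \<Rightarrow> nat"

definition mesh_domain :: "box_mesh \<Rightarrow> point set" where
  "mesh_domain M = \<Union>(elements M)"

definition mesh_vertices :: "box_mesh \<Rightarrow> point set" where
  "mesh_vertices M = (\<Union>\<beta>\<in>elements M. corners \<beta>)"

text \<open>
  The segments are automatically axis-aligned, because they lie in the boundaries of
  finitely many axis-aligned rectangles.
\<close>

definition meshlines :: "box_mesh \<Rightarrow> point set set" where
  "meshlines M =
     {closed_segment u v | u v.
        u \<noteq> v \<and> closed_segment u v \<subseteq> (\<Union>\<beta>\<in>elements M. frontier \<beta>) \<and>
        closed_segment u v \<inter> mesh_vertices M = {u, v}}"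

definition dir_meshlines :: "dir \<Rightarrow> box_mesh \<Rightarrow> point set set" where
  "dir_meshlines k M = {g \<in> meshlines M. is_segment k g}"

definition admissible_mesh :: "nat \<times> nat \<Rightarrow> box_mesh \<Rightarrow> bool" where
  "admissible_mesh p M \<longleftrightarrow>
     box_partition (mesh_domain M) (elements M) \<and>
     (\<forall>k. \<forall>g\<in>dir_meshlines k M. 1 \<le> mline_mult M g \<and> mline_mult M g \<le> deg p k + 1)"


section \<open>Splits\<close>

definition traverses_element :: "point set \<Rightarrow> point set \<Rightarrow> bool" where
  "traverses_element \<gamma> \<beta> \<longleftrightarrow> (\<exists>k. is_segment k \<gamma>) \<and> \<not> connected (\<beta> - \<gamma>)"

text \<open>
  A finite union of axis-aligned segments consists of contiguous colinear segments of direction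
  \<open>k\<close> exactly when the union is again a segment of direction \<open>k\<close>.
\<close>

definition is_split :: "dir \<Rightarrow> box_mesh \<Rightarrow> point set \<Rightarrow> bool" where
  "is_split k M \<gamma> \<longleftrightarrow>
     is_segment k \<gamma> \<and>
     (\<exists>S. finite S \<and> S \<noteq> {} \<and> \<gamma> = \<Union>S \<and>
        (\<forall>s\<in>S. is_segment k s \<and>
           ((\<exists>\<beta>\<in>elements M. traverses_element s \<beta>) \<or> s \<in> meshlines M)))"

definition split_of_mesh :: "dir \<Rightarrow> box_mesh \<Rightarrow> point set \<Rightarrow> bool" where
  "split_of_mesh k M \<gamma> \<longleftrightarrow>
     is_segment k \<gamma> \<and>
     (\<exists>S. finite S \<and> S \<noteq> {} \<and> \<gamma> = \<Union>S \<and> S \<subseteq> dir_meshlines k M)"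

definition maximal_split :: "dir \<Rightarrow> box_mesh \<Rightarrow> point set \<Rightarrow> bool" where
  "maximal_split k M \<gamma> \<longleftrightarrow>
     split_of_mesh k M \<gamma> \<and>
     (\<forall>g\<in>meshlines M. g \<inter> \<gamma> \<noteq> {} \<and> collinear (g \<union> \<gamma>) \<longrightarrow> g \<subseteq> \<gamma>)"

definition constant_splits :: "box_mesh \<Rightarrow> bool" where
  "constant_splits M \<longleftrightarrow>
     (\<forall>k \<gamma>. maximal_split k M \<gamma> \<longrightarrow>
        (\<forall>g\<in>meshlines M. \<forall>h\<in>meshlines M.
           g \<subseteq> \<gamma> \<and> h \<subseteq> \<gamma> \<longrightarrow> mline_mult M g = mline_mult M h))"

text \<open>Only meaningful for a split of a mesh with constant splits.\<close>

definition split_mult :: "box_mesh \<Rightarrow> point set \<Rightarrow> nat" where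
  "split_mult M \<gamma> = (THE m. \<forall>g\<in>meshlines M. g \<subseteq> \<gamma> \<longrightarrow> mline_mult M g = m)"

definition split_length :: "dir \<Rightarrow> box_mesh \<Rightarrow> point set \<Rightarrow> nat" where
  "split_length k M \<gamma> =
     (\<Sum>v \<in> mesh_vertices M \<inter> \<gamma>. Max (mline_mult M ` {g \<in> dir_meshlines (orth k) M. v \<in> g}))"


section \<open>Insertion of a split and LR-meshes\<close>

definition insert_elements :: "box_mesh \<Rightarrow> point set \<Rightarrow> point set set" where
  "insert_elements M \<gamma> =
     {\<beta> \<in> elements M. \<not> traverses_element \<gamma> \<beta>} \<union>
     (\<Union>\<beta> \<in> {\<beta> \<in> elements M. traverses_element \<gamma> \<beta>}. closure ` components (\<beta> - \<gamma>))"

text \<open>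
  The cut may create new vertices on old meshlines orthogonal to \<open>\<gamma>\<close> and so break them in
  pieces: a meshline of the new mesh that is not in \<open>\<gamma>\<close> has the multiplicity of the unique old
  meshline containing it.
\<close>

definition insert_split :: "box_mesh \<Rightarrow> point set \<Rightarrow> nat \<Rightarrow> box_mesh" where
  "insert_split M \<gamma> m =
     \<lparr> elements = insert_elements M \<gamma>,
       mline_mult = (\<lambda>g.
         if g \<subseteq> \<gamma> then (if g \<in> meshlines M then mline_mult M g + m else m)
         else mline_mult M (THE h. h \<in> meshlines M \<and> g \<subseteq> h)) \<rparr>"

definition tensor_product_mesh :: "box_mesh \<Rightarrow> bool" where
  "tensor_product_mesh M \<longleftrightarrow>
     (\<exists>\<tau>1 \<tau>2 :: real list.
        2 \<le> length \<tau>1 \<and> 2 \<le> length \<tau>2 \<and> sorted_wrt (<) \<tau>1 \<and> sorted_wrt (<) \<tau>2 \<and>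
        elements M =
          {{\<tau>1 ! i .. \<tau>1 ! (i + 1)} \<times> {\<tau>2 ! j .. \<tau>2 ! (j + 1)} | i j.
             i + 1 < length \<tau>1 \<and> j + 1 < length \<tau>2})"

definition lr_rule1 :: "nat \<times> nat \<Rightarrow> box_mesh \<Rightarrow> bool" where
  "lr_rule1 p M \<longleftrightarrow>
     (\<forall>k. deg p k + 2 \<le> (\<Sum>\<gamma> \<in> {\<gamma>. maximal_split k M \<gamma>}. split_mult M \<gamma>))"

definition lr_rule2 :: "nat \<times> nat \<Rightarrow> box_mesh \<Rightarrow> bool" where
  "lr_rule2 p M \<longleftrightarrow>
     (\<forall>k \<gamma>. maximal_split k M \<gamma> \<longrightarrow> deg p (orth k) + 2 \<le> split_length k M \<gamma>)"

inductive lr_mesh :: "nat \<times> nat \<Rightarrow> box_mesh \<Rightarrow> bool" for p where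
  tensor:
    "tensor_product_mesh M \<Longrightarrow> admissible_mesh p M \<Longrightarrow> constant_splits M \<Longrightarrow>
     lr_rule1 p M \<Longrightarrow> lr_rule2 p M \<Longrightarrow> lr_mesh p M"
| insertion:
    "lr_mesh p M \<Longrightarrow> is_split k M \<gamma> \<Longrightarrow> 1 \<le> m \<Longrightarrow>
     admissible_mesh p (insert_split M \<gamma> m) \<Longrightarrow> constant_splits (insert_split M \<gamma> m) \<Longrightarrow>
     lr_rule2 p (insert_split M \<gamma> m) \<Longrightarrow> lr_mesh p (insert_split M \<gamma> m)"


section \<open>B-splines\<close>

text \<open>
  \<open>cox_de_boor d t i\<close> is the B-spline of degree \<open>d\<close> on the knots \<open>t i, \<dots>, t (i + d + 1)\<close>. Fractions
  with denominator zero vanish by the convention \<open>x / 0 = 0\<close>.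
\<close>

primrec cox_de_boor :: "nat \<Rightarrow> (nat \<Rightarrow> real) \<Rightarrow> nat \<Rightarrow> real \<Rightarrow> real" where
  "cox_de_boor 0 t i s = indicator {t i ..< t (i + 1)} s"
| "cox_de_boor (Suc d) t i s =
     (s - t i) / (t (i + d + 1) - t i) * cox_de_boor d t i s +
     (t (i + d + 2) - s) / (t (i + d + 2) - t (i + 1)) * cox_de_boor d t (i + 1) s"

text \<open>A knot vector of length \<open>p + 2\<close> gives a B-spline of degree \<open>p\<close>; list indices start at 0.\<close>

definition bspline :: "real list \<Rightarrow> real \<Rightarrow> real" where
  "bspline t s = cox_de_boor (length t - 2) (\<lambda>i. t ! i) 0 s"

definition bspline2 :: "real list \<Rightarrow> real list \<Rightarrow> point \<Rightarrow> real" where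
  "bspline2 x y z = bspline x (fst z) * bspline y (snd z)"

definition knot_vectors :: "nat \<times> nat \<Rightarrow> real list \<Rightarrow> real list \<Rightarrow> bool" where
  "knot_vectors p x y \<longleftrightarrow>
     length x = fst p + 2 \<and> sorted x \<and> length y = snd p + 2 \<and> sorted y"

definition bsupport :: "real list \<Rightarrow> real list \<Rightarrow> point set" where
  "bsupport x y = {hd x .. last x} \<times> {hd y .. last y}"

text \<open>The splits of a B-spline, each paired with its multiplicity.\<close>

definition bspline_splits :: "real list \<Rightarrow> real list \<Rightarrow> (point set \<times> nat) set" where
  "bspline_splits x y =
     {({t} \<times> {hd y .. last y}, count_list x t) | t. t \<in> set x} \<union>
     {({hd x .. last x} \<times> {t}, count_list y t) | t. t \<in> set y}"

definition traverses_bspline :: "point set \<Rightarrow> real list \<Rightarrow> real list \<Rightarrow> bool" where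
  "traverses_bspline \<gamma> x y \<longleftrightarrow> \<not> connected (interior (bsupport x y) - \<gamma>)"


section \<open>Minimal support\<close>

definition has_support :: "nat \<times> nat \<Rightarrow> box_mesh \<Rightarrow> real list \<Rightarrow> real list \<Rightarrow> bool" where
  "has_support p M x y \<longleftrightarrow>
     knot_vectors p x y \<and> bsupport x y \<subseteq> mesh_domain M \<and>
     (\<forall>(\<sigma>, m) \<in> bspline_splits x y.
        \<exists>k \<gamma>. split_of_mesh k M \<gamma> \<and> \<sigma> \<subseteq> \<gamma> \<and> m \<le> split_mult M \<gamma>)"

definition has_minimal_support ::
    "nat \<times> nat \<Rightarrow> box_mesh \<Rightarrow> real list \<Rightarrow> real list \<Rightarrow> bool" where
  "has_minimal_support p M x y \<longleftrightarrow>
     has_support p M x y \<and>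
     (\<forall>k \<gamma>. split_of_mesh k M \<gamma> \<and> \<gamma> \<inter> interior (bsupport x y) \<noteq> {} \<longrightarrow>
        (traverses_bspline \<gamma> x y \<longleftrightarrow>
           (\<exists>\<sigma>. (\<sigma>, split_mult M \<gamma>) \<in> bspline_splits x y \<and> \<sigma> \<subseteq> \<gamma>)))"

definition ms_bsplines :: "nat \<times> nat \<Rightarrow> box_mesh \<Rightarrow> (point \<Rightarrow> real) set" where
  "ms_bsplines p M = {bspline2 x y | x y. has_minimal_support p M x y}"

end

theory Submission
  imports Defs
begin

text \<open>
  In a relation \<open>\<Sum> \<alpha>\<^sub>j X\<^sub>j \<otimes> Y\<^sub>j = 0\<close> call \<open>j\<close> left if \<open>X\<^sub>j\<close> starts at the smallest knot with the largest
  multiplicity occurring there; right, bottom and top are analogous. Comparing leading terms at the left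
  end gives a relation between the \<open>Y\<^sub>j\<close> with \<open>j\<close> left. Since a B-spline determines its knots (through
  its moments) and, by minimality of the support, two left B-splines with the same \<open>Y\<close> coincide, there
  are at least three left ones; likewise for the other three sides. With at most five B-splines in total some
  \<open>b\<close> is left and right, some \<open>b'\<close> is bottom and top, and minimality gives \<open>b = b'\<close>. Comparing leading
  terms at the corners yields four further B-splines, one for each corner. The knot vectors of \<open>b\<close> are then
  related to those of the corners in pairs; substituting these relations shows that two corner B-splines on
  a common side have equal knot vectors along that side. Their supports touch, so their mesh lines join to
  lines across the support of \<open>b\<close>, and minimality of \<open>b\<close> gives a contradiction.
\<close>

section \<open>Cox--de Boor splines\<close>

lemma cox_de_boor_outside:
  assumes "mono_on {i..i + d + 1} t" "s < t i \<or> t (i + d + 1) \<le> s"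
  shows "cox_de_boor d t i s = 0"
  using assms
proof (induction d arbitrary: i)
  case 0
  then show ?case by auto
next
  case (Suc d)
  have mono: "mono_on {i..i + d + 1} t" "mono_on {i + 1..i + 1 + d + 1} t"
    using Suc.prems(1) by (auto intro: mono_on_subset)
  have le: "t i \<le> t (i + 1)" "t (i + d + 1) \<le> t (i + d + 2)"
    using Suc.prems(1) by (auto intro: mono_onD)
  have "cox_de_boor d t i s = 0" "cox_de_boor d t (i + 1) s = 0"
    using Suc.IH[OF mono(1)] Suc.IH[OF mono(2)] Suc.prems(2) le by auto
  then show ?case by simp
qed

text \<open>Both summands of the recursion are nonnegative, and one whose knot range contains the
  interval from \<open>t j\<close> to \<open>t (j + 1)\<close> is positive. The point stays off the
  knots because the value at a knot can be zero.\<close>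

lemma cox_de_boor_pos:
  assumes "mono_on {i..i + d + 1} t" "i \<le> j" "j \<le> i + d" "t j < s" "s < t (j + 1)"
  shows "0 < cox_de_boor d t i s"
  using assms
proof (induction d arbitrary: i)
  case 0
  then have "j = i" by simp
  with 0 show ?case by simp
next
  case (Suc d)
  have mono: "mono_on {i..i + d + 1} t" "mono_on {i + 1..i + 1 + d + 1} t"
    using Suc.prems(1) by (auto intro: mono_on_subset)
  have bounds: "t i < s" "s < t (i + d + 2)"
    using mono_onD[OF Suc.prems(1), of i j] mono_onD[OF Suc.prems(1), of "j + 1" "i + d + 2"] Suc.prems
    by auto
  have nonneg: "0 \<le> cox_de_boor d t i s \<and> 0 \<le> cox_de_boor d t (i + 1) s"
  proof
    show "0 \<le> cox_de_boor d t i s"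
    proof (cases "j \<le> i + d")
      case True
      then show ?thesis using Suc.IH[OF mono(1)] Suc.prems by auto
    next
      case False
      then have "j = i + d + 1" using Suc.prems by simp
      then show ?thesis using cox_de_boor_outside[OF mono(1), of s] Suc.prems by simp
    qed
    show "0 \<le> cox_de_boor d t (i + 1) s"
    proof (cases "i + 1 \<le> j")
      case True
      then show ?thesis using Suc.IH[OF mono(2)] Suc.prems by auto
    next
      case False
      then have "j = i" using Suc.prems by simp
      then show ?thesis using cox_de_boor_outside[OF mono(2), of s] Suc.prems by simp
    qed
  qed
  have le: "t i \<le> t (i + d + 1)" "t (i + 1) \<le> t (i + d + 2)"
    using Suc.prems(1) by (auto intro: mono_onD)
  have summands: "0 \<le> (s - t i) / (t (i + d + 1) - t i) * cox_de_boor d t i s"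
    "0 \<le> (t (i + d + 2) - s) / (t (i + d + 2) - t (i + 1)) * cox_de_boor d t (i + 1) s"
    using nonneg le bounds by auto
  show ?case
  proof (cases "j \<le> i + d")
    case True
    then have "0 < cox_de_boor d t i s" using Suc.IH[OF mono(1)] Suc.prems by auto
    moreover have "t i < t (i + d + 1)"
      using mono_onD[OF Suc.prems(1), of "j + 1" "i + d + 1"] Suc.prems bounds True by auto
    ultimately have "0 < (s - t i) / (t (i + d + 1) - t i) * cox_de_boor d t i s"
      using bounds by simp
    with summands show ?thesis by simp
  next
    case False
    then have "j = i + d + 1" using Suc.prems by simp
    then have "0 < cox_de_boor d t (i + 1) s" using Suc.IH[OF mono(2)] Suc.prems by auto
    moreover have "t (i + 1) < t (i + d + 2)"
      using mono_onD[OF Suc.prems(1), of "i + 1" "j"] Suc.prems bounds \<open>j = i + d + 1\<close> by auto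
    ultimately have "0 < (t (i + d + 2) - s) / (t (i + d + 2) - t (i + 1)) * cox_de_boor d t (i + 1) s"
      using bounds by simp
    with summands show ?thesis by simp
  qed
qed

text \<open>A starting knot of multiplicity \<open>m\<close> gives order of vanishing exactly
  \<open>d + 1 - m\<close> from the right. In the recursion the first summand gains the factor
  \<open>s - a\<close>, while the spline in the second has lost one copy of the knot. Divided by the
  expected power, both summands have nonnegative limits, and at least one limit is positive.\<close>

lemma cox_de_boor_start:
  assumes "mono_on {i..i + d + 1} t" "1 \<le> m" "m \<le> d + 1"
    and "\<And>j. j < m \<Longrightarrow> t (i + j) = a" "a < t (i + m)"
  shows "\<exists>c>0. ((\<lambda>s. cox_de_boor d t i s / (s - a) ^ (d + 1 - m)) \<longlongrightarrow> c) (at_right a)"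
  using assms
proof (induction d arbitrary: i m)
  case 0
  then have "m = 1" by simp
  with 0 have "t i = a" "a < t (i + 1)" by auto
  then have "eventually (\<lambda>s. 1 = cox_de_boor 0 t i s / (s - a) ^ (0 + 1 - m)) (at_right a)"
    using eventually_at_right_real[of a "t (i + 1)"]
    by (auto elim!: eventually_mono simp: \<open>m = 1\<close>)
  then have "((\<lambda>s. cox_de_boor 0 t i s / (s - a) ^ (0 + 1 - m)) \<longlongrightarrow> 1) (at_right a)"
    by (rule Lim_transform_eventually[OF tendsto_const])
  then show ?case by (intro exI[of _ 1]) simp
next
  case (Suc d)
  have mono: "mono_on {i..i + d + 1} t" "mono_on {i + 1..i + 1 + d + 1} t"
    using Suc.prems(1) by (auto intro: mono_on_subset)
  have ti: "t i = a" using Suc.prems(2) Suc.prems(4)[of 0] by simp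
  define u where "u s = (s - t i) / (t (i + d + 1) - t i) * cox_de_boor d t i s" for s
  define v where "v s = (t (i + d + 2) - s) / (t (i + d + 2) - t (i + 1)) * cox_de_boor d t (i + 1) s" for s
  define k where "k = Suc d + 1 - m"
  have "\<exists>c\<ge>0. (m \<le> d + 1 \<longrightarrow> c > 0) \<and> ((\<lambda>s. u s / (s - a) ^ k) \<longlongrightarrow> c) (at_right a)"
  proof (cases "m \<le> d + 1")
    case True
    then obtain c where c: "c > 0"
      "((\<lambda>s. cox_de_boor d t i s / (s - a) ^ (d + 1 - m)) \<longlongrightarrow> c) (at_right a)"
      using Suc.IH[OF mono(1) Suc.prems(2) True Suc.prems(4,5)] by blast
    have lt: "a < t (i + d + 1)"
      using mono_onD[OF mono(1), of "i + m" "i + d + 1"] True Suc.prems by auto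
    have kk: "k = Suc (d + 1 - m)" using True by (simp add: k_def)
    have "((\<lambda>s. cox_de_boor d t i s / (s - a) ^ (d + 1 - m) / (t (i + d + 1) - a))
        \<longlongrightarrow> c / (t (i + d + 1) - a)) (at_right a)"
      using lt by (intro tendsto_divide c tendsto_const) auto
    then have "((\<lambda>s. u s / (s - a) ^ k) \<longlongrightarrow> c / (t (i + d + 1) - a)) (at_right a)"
      by (rule Lim_transform_eventually, intro eventually_mono[OF eventually_at_right_less])
        (auto simp: u_def ti kk)
    then show ?thesis using c lt by (intro exI[of _ "c / (t (i + d + 1) - a)"]) simp
  next
    case False
    \<comment> \<open>Here \<open>m = d + 2\<close>: all knots of the first lower-degree spline
      coincide, and the convention for zero denominators removes the summand.\<close>
    then have "t (i + d + 1) = t i"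
      using Suc.prems(3) Suc.prems(4)[of "d + 1"] ti by simp
    then have "u s = 0" for s by (simp add: u_def)
    with False show ?thesis by (intro exI[of _ 0]) simp
  qed
  then obtain c1 where c1: "c1 \<ge> 0" "m \<le> d + 1 \<Longrightarrow> c1 > 0"
    "((\<lambda>s. u s / (s - a) ^ k) \<longlongrightarrow> c1) (at_right a)" by blast
  have "\<exists>c\<ge>0. (2 \<le> m \<longrightarrow> c > 0) \<and> ((\<lambda>s. v s / (s - a) ^ k) \<longlongrightarrow> c) (at_right a)"
  proof (cases "2 \<le> m")
    case True
    have eqs: "\<And>j. j < m - 1 \<Longrightarrow> t (i + 1 + j) = a" "a < t (i + 1 + (m - 1))"
      using Suc.prems True Suc.prems(4)[of "Suc _"] by auto
    have "1 \<le> m - 1" "m - 1 \<le> d + 1" "d + 1 - (m - 1) = k"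
      using True Suc.prems(3) by (auto simp: k_def)
    then obtain c where c: "c > 0"
      "((\<lambda>s. cox_de_boor d t (i + 1) s / (s - a) ^ k) \<longlongrightarrow> c) (at_right a)"
      using Suc.IH[OF mono(2) _ _ eqs] by auto
    have t1: "t (i + 1) = a" using Suc.prems(4)[of 1] True by simp
    have lt: "a < t (i + d + 2)"
      using mono_onD[OF Suc.prems(1), of "i + m" "i + d + 2"] Suc.prems by auto
    have "((\<lambda>s. (t (i + d + 2) - s) / (t (i + d + 2) - a)) \<longlongrightarrow> (t (i + d + 2) - a) / (t (i + d + 2) - a))
      (at_right a)"
      using lt by (intro tendsto_intros) auto
    then have "((\<lambda>s. (t (i + d + 2) - s) / (t (i + d + 2) - a)) \<longlongrightarrow> 1) (at_right a)" using lt by simp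
    from tendsto_mult[OF this c(2)]
    have "((\<lambda>s. v s / (s - a) ^ k) \<longlongrightarrow> c) (at_right a)" by (simp add: v_def t1[simplified])
    with c show ?thesis by (intro exI[of _ c]) simp
  next
    case False
    \<comment> \<open>The second lower-degree spline starts strictly beyond \<open>a\<close>, so it
      is zero just to the right of \<open>a\<close>.\<close>
    then have m1: "m = 1" using Suc.prems(2) by simp
    then have lt: "a < t (i + 1)" using Suc.prems(5) by simp
    have "eventually (\<lambda>s. 0 = v s / (s - a) ^ k) (at_right a)"
      using eventually_at_right_real[OF lt]
      by (rule eventually_mono) (use cox_de_boor_outside[OF mono(2)] in \<open>auto simp: v_def\<close>)
    then have "((\<lambda>s. v s / (s - a) ^ k) \<longlongrightarrow> 0) (at_right a)"
      by (rule Lim_transform_eventually[OF tendsto_const])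
    with False show ?thesis by (intro exI[of _ 0]) simp
  qed
  then obtain c2 where c2: "c2 \<ge> 0" "2 \<le> m \<Longrightarrow> c2 > 0"
    "((\<lambda>s. v s / (s - a) ^ k) \<longlongrightarrow> c2) (at_right a)" by blast
  have "((\<lambda>s. u s / (s - a) ^ k + v s / (s - a) ^ k) \<longlongrightarrow> c1 + c2) (at_right a)"
    by (intro tendsto_add c1 c2)
  moreover have "(\<lambda>s. u s / (s - a) ^ k + v s / (s - a) ^ k) = (\<lambda>s. cox_de_boor (Suc d) t i s / (s - a) ^ k)"
    by (simp add: u_def v_def add_divide_distrib)
  moreover have "c1 + c2 > 0"
  proof (cases "2 \<le> m")
    case True
    then show ?thesis using c1(1) c2(2) by simp
  next
    case False
    then have "m \<le> d + 1" by simp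
    then show ?thesis using c1(2) c2(1) by simp
  qed
  ultimately show ?case unfolding k_def by auto
qed


text \<open>The index map \<open>N - j\<close> reverses the knot order. Knots are excluded because
  the half-open intervals of degree 0 are not invariant under the change of sign.\<close>

lemma cox_de_boor_reflect:
  assumes "i + d + 1 \<le> N" "s \<notin> t ` {i..i + d + 1}"
  shows "cox_de_boor d t i s = cox_de_boor d (\<lambda>j. - t (N - j)) (N - (i + d + 1)) (- s)"
  using assms
proof (induction d arbitrary: i)
  case 0
  then have "N - (N - i) = i" "N - (N - Suc i) = Suc i" "Suc (N - Suc i) = N - i" "s \<noteq> t i" "s \<noteq> t (i + 1)"
    by auto
  then show ?case by (auto simp: indicator_def)
next
  case (Suc d)
  define k where "k = N - (i + d + 2)"
  have idx: "N - (i + d + 1) = k + 1" "N - (i + 1 + d + 1) = k" "N - k = i + d + 2"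
    "N - (k + d + 1) = i + 1" "N - (k + d + 2) = i" "N - (k + 1) = i + d + 1"
    using Suc.prems(1) by (auto simp: k_def)
  have sub: "s \<notin> t ` {i..i + d + 1}" "s \<notin> t ` {i + 1..i + 1 + d + 1}"
    using Suc.prems(2) by auto
  have "cox_de_boor d t i s = cox_de_boor d (\<lambda>j. - t (N - j)) (k + 1) (- s)"
    "cox_de_boor d t (i + 1) s = cox_de_boor d (\<lambda>j. - t (N - j)) k (- s)"
    using Suc.IH[of i] Suc.IH[of "i + 1"] sub Suc.prems(1) unfolding idx by simp_all
  then have "cox_de_boor (Suc d) t i s = cox_de_boor (Suc d) (\<lambda>j. - t (N - j)) k (- s)"
    unfolding cox_de_boor.simps idx by (simp add: algebra_simps)
  then show ?case by (simp add: k_def)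
qed

text \<open>Reflection reduces this to \<open>cox_de_boor_start\<close>; a left limit at
  \<open>b\<close> eventually avoids the finitely many knots at which the reflection identity may
  fail.\<close>

lemma cox_de_boor_end:
  assumes mono: "mono_on {0..d + 1} t" and m: "1 \<le> m" "m \<le> d + 1"
    and "\<And>j. j < m \<Longrightarrow> t (d + 1 - j) = b" "t (d + 1 - m) < b"
  shows "\<exists>c>0. ((\<lambda>s. cox_de_boor d t 0 s / (b - s) ^ (d + 1 - m)) \<longlongrightarrow> c) (at_left b)"
proof -
  define t' where "t' = (\<lambda>j. - t (d + 1 - j))"
  have "mono_on {0..0 + d + 1} t'"
    unfolding t'_def by (auto intro!: mono_onI mono_onD[OF mono])
  from cox_de_boor_start[OF this m, of "- b"] assms(4,5) obtain c where c: "c > 0"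
    "((\<lambda>s. cox_de_boor d t' 0 s / (s + b) ^ (d + 1 - m)) \<longlongrightarrow> c) (at_right (- b))"
    by (auto simp: t'_def add.commute)
  then have "((\<lambda>s. cox_de_boor d t' 0 (- s) / (b - s) ^ (d + 1 - m)) \<longlongrightarrow> c) (at_left b)"
    by (simp add: at_left_minus filterlim_filtermap add.commute)
  moreover have "eventually (\<lambda>s. s \<notin> t ` {0..d + 1}) (at_left b)"
  proof -
    have "open (- (t ` {0..d + 1} - {b}))" by (intro open_Compl finite_imp_closed) auto
    then have "eventually (\<lambda>s. s \<notin> t ` {0..d + 1} - {b}) (nhds b)"
      by (rule eventually_mono[OF eventually_nhds_in_open]) auto
    then show ?thesis unfolding eventually_at_filter by (rule eventually_mono) auto
  qed
  then have "eventually (\<lambda>s. cox_de_boor d t' 0 (- s) / (b - s) ^ (d + 1 - m)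
      = cox_de_boor d t 0 s / (b - s) ^ (d + 1 - m)) (at_left b)"
    by (rule eventually_mono)
      (use cox_de_boor_reflect[of 0 d "d + 1" _ t] in \<open>auto simp: t'_def\<close>)
  ultimately have "((\<lambda>s. cox_de_boor d t 0 s / (b - s) ^ (d + 1 - m)) \<longlongrightarrow> c) (at_left b)"
    by (rule Lim_transform_eventually)
  with c show ?thesis by blast
qed

section \<open>Moments\<close>

definition moment :: "nat \<Rightarrow> (nat \<Rightarrow> real) \<Rightarrow> nat \<Rightarrow> nat \<Rightarrow> real" where
  "moment d t i k = (\<integral>s. s ^ k * cox_de_boor d t i s \<partial>lborel)"

text \<open>This is the formal expansion of the integral of (1 - s X)^(-(d + 2)) against the spline:
  the binomials are the coefficients of that negative power.\<close>

definition moment_series :: "nat \<Rightarrow> (nat \<Rightarrow> real) \<Rightarrow> nat \<Rightarrow> real fps" where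
  "moment_series d t i = Abs_fps (\<lambda>k. of_nat ((k + d + 1) choose k) * moment d t i k)"

definition knot_factor :: "real \<Rightarrow> real fps" where
  "knot_factor a = 1 - fps_const a * fps_X"

lemma knot_factor_nth_0: "fps_nth (knot_factor a) 0 = 1"
  by (simp add: knot_factor_def)

lemma knot_factor_nonzero: "knot_factor a \<noteq> 0"
  using knot_factor_nth_0[of a] by (metis fps_zero_nth zero_neq_one)

lemma fps_deriv_knot_factor: "fps_deriv (knot_factor a) = - fps_const a"
  by (simp add: knot_factor_def)

lemma integrable_power_indicator:
  "integrable lborel (\<lambda>s. s ^ k * indicator {a..<b} s :: real)"
proof -
  have "set_integrable lborel {a..b} (\<lambda>s. s ^ k :: real)"
    by (intro borel_integrable_atLeastAtMost' continuous_intros)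
  then have "set_integrable lborel {a..<b} (\<lambda>s. s ^ k :: real)"
    by (rule set_integrable_subset) auto
  then show ?thesis by (simp add: set_integrable_def mult.commute)
qed

text \<open>Arranged for termwise integration: each fraction involves only the moments of orders
  \<open>k\<close> and \<open>k + 1\<close> of one lower-degree spline.\<close>

lemma cox_de_boor_Suc_power:
  "s ^ k * cox_de_boor (Suc d) t i s =
     (s ^ (k + 1) * cox_de_boor d t i s - t i * (s ^ k * cox_de_boor d t i s)) / (t (i + d + 1) - t i)
   + (t (i + d + 2) * (s ^ k * cox_de_boor d t (i + 1) s) - s ^ (k + 1) * cox_de_boor d t (i + 1) s)
       / (t (i + d + 2) - t (i + 1))"
  by (simp add: diff_divide_distrib add_divide_distrib algebra_simps)

lemma integrable_moment: "integrable lborel (\<lambda>s. s ^ k * cox_de_boor d t i s)"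
proof (induction d arbitrary: i k)
  case 0
  then show ?case by (simp add: integrable_power_indicator)
next
  case (Suc d)
  show ?case unfolding cox_de_boor_Suc_power
    by (intro Bochner_Integration.integrable_add Bochner_Integration.integrable_diff
        integrable_divide integrable_mult_right Suc.IH)
qed

lemma moment_Suc:
  "moment (Suc d) t i k =
     (moment d t i (k + 1) - t i * moment d t i k) / (t (i + d + 1) - t i)
   + (t (i + d + 2) * moment d t (i + 1) k - moment d t (i + 1) (k + 1)) / (t (i + d + 2) - t (i + 1))"
  unfolding moment_def cox_de_boor_Suc_power
  by (simp only: Bochner_Integration.integral_add Bochner_Integration.integral_diff
      integral_divide_zero integral_mult_right_zero
      Bochner_Integration.integrable_diff integrable_divide integrable_mult_right integrable_moment)

lemma moment_series_0:
  assumes "t i \<le> t (i + 1)"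
  shows "moment_series 0 t i * (knot_factor (t i) * knot_factor (t (i + 1)))
    = fps_const (t (i + 1) - t i)"
proof -
  \<comment> \<open>The geometric series a / (1 - a X). The weight \<open>k + 1\<close> in degree 0
    cancels the denominator of the moment, so the moment series is a difference of two such
    series.\<close>
  define S where "S a = Abs_fps (\<lambda>k. a ^ (k + 1))" for a :: real
  have S: "S a * knot_factor a = fps_const a" for a
  proof -
    have "S a * knot_factor a = S a - fps_const a * (S a * fps_X)"
      by (simp only: knot_factor_def right_diff_distrib mult_1_right mult.left_commute)
    also have "\<dots> = fps_const a"
    proof (rule fps_ext)
      fix k show "fps_nth (S a - fps_const a * (S a * fps_X)) k = fps_nth (fps_const a) k"
        by (cases k) (simp_all add: S_def)
    qed
    finally show ?thesis .
  qed
  \<comment> \<open>Closing the interval changes the integrand only at one point, a null set, and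
    makes the integral formula for powers applicable.\<close>
  have "moment 0 t i k = (\<integral>s. s ^ k * indicator {t i..t (i + 1)} s \<partial>lborel)" for k
    unfolding moment_def
  proof (rule integral_cong_AE)
    show "(\<lambda>s. s ^ k * cox_de_boor 0 t i s) \<in> borel_measurable lborel"
      using integrable_moment[of k 0 t i] by simp
    show "(\<lambda>s. s ^ k * indicator {t i..t (i + 1)} s :: real) \<in> borel_measurable lborel"
      by measurable
    show "AE s in lborel. s ^ k * cox_de_boor 0 t i s = s ^ k * indicator {t i..t (i + 1)} s"
      by (rule AE_mp[OF AE_lborel_singleton[of "t (i + 1)"]]) (auto simp: indicator_def)
  qed
  then have "moment 0 t i k = (t (i + 1) ^ Suc k - t i ^ Suc k) / Suc k" for k
    using integral_power[OF assms] by simp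
  then have "moment_series 0 t i = S (t (i + 1)) - S (t i)"
    by (intro fps_ext) (simp add: moment_series_def S_def)
  moreover have "(p - q) * (u * v) = p * v * u - q * u * v" for p q u v :: "real fps"
    by (simp add: algebra_simps)
  ultimately have "moment_series 0 t i * (knot_factor (t i) * knot_factor (t (i + 1)))
    = S (t (i + 1)) * knot_factor (t (i + 1)) * knot_factor (t i)
      - S (t i) * knot_factor (t i) * knot_factor (t (i + 1))"
    by (simp only:)
  also have "\<dots> = fps_const (t (i + 1) - t i)"
    unfolding S by (simp add: knot_factor_def algebra_simps flip: fps_const_sub)
  finally show ?thesis .
qed

text \<open>Handles one fraction of the moment recursion, with end knot \<open>e\<close> and
  denominator \<open>\<delta>\<close>. The series \<open>N\<close> stands for the moment series
  divided by \<open>\<delta>\<close> and keeps its meaning when \<open>\<delta> = 0\<close>, so that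
  the induction below needs no distinction of degenerate cases.\<close>

lemma moment_term:
  assumes series: "moment_series d t i * knot_factor e * W = fps_const (\<delta> * \<kappa>)"
    and degenerate: "\<delta> = 0 \<Longrightarrow> W = knot_factor e ^ (d + 1)"
  shows "\<exists>N. N * knot_factor e * W = fps_const \<kappa> \<and>
    Abs_fps (\<lambda>k. of_nat ((k + d + 2) choose k) * ((moment d t i (k + 1) - e * moment d t i k) / \<delta>))
    = fps_const (1 / (real d + 2)) * (knot_factor e * fps_deriv N) - fps_const e * N"
proof (cases "\<delta> = 0")
  case True
  define u where "u = knot_factor e"
  \<comment> \<open>With all knots equal to \<open>e\<close> there is nothing to divide, but the
    closed form of the quotient still makes sense.\<close>
  define N where "N = fps_const \<kappa> * inverse (u ^ (d + 2))"
  have inv: "inverse (u ^ (d + 2)) * u ^ (d + 2) = 1"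
    by (rule inverse_mult_eq_1) (simp add: u_def fps_nth_power_0 knot_factor_nth_0)
  have N: "N * u ^ (d + 2) = fps_const \<kappa>"
    unfolding N_def mult.assoc inv by simp
  \<comment> \<open>Differentiating the constant product gives u N' = (d + 2) e N. Hence the claimed
    expression is zero, in agreement with the vanishing fraction.\<close>
  then have "fps_deriv (N * u ^ (d + 2)) = 0" by simp
  moreover have "fps_deriv (u ^ (d + 2)) = - of_nat (d + 2) * fps_const e * u ^ (d + 1)"
    by (subst fps_deriv_power') (simp add: fps_deriv_knot_factor u_def algebra_simps flip: fps_const_neg)
  ultimately have "u ^ (d + 1) * (fps_deriv N * u - of_nat (d + 2) * fps_const e * N) = 0"
    by (simp only: fps_deriv_mult, simp only: power_add) (simp add: power2_eq_square algebra_simps)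
  moreover have "u ^ (d + 1) \<noteq> 0" unfolding u_def using knot_factor_nonzero by simp
  ultimately have "fps_deriv N * u - of_nat (d + 2) * fps_const e * N = 0"
    by (simp only: mult_eq_0_iff) simp
  then have "fps_deriv N * u = fps_const (real (d + 2) * e) * N"
    unfolding fps_const_mult[symmetric] fps_of_nat by simp
  then have "u * fps_deriv N = fps_const (real (d + 2) * e) * N" by (simp only: mult.commute)
  then have "fps_const (1 / (real d + 2)) * (u * fps_deriv N)
      = fps_const (1 / (real d + 2) * (real (d + 2) * e)) * N"
    by (simp only: fps_const_mult[symmetric] mult.assoc)
  moreover have "1 / (real d + 2) * (real (d + 2) * e) = e" by (simp add: add.commute)
  ultimately have "fps_const (1 / (real d + 2)) * (u * fps_deriv N) - fps_const e * N = 0" by simp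
  moreover have "N * u * W = fps_const \<kappa>" using N degenerate[OF True] by (simp add: u_def mult_ac)
  ultimately show ?thesis using True by (intro exI[of _ N]) (simp add: u_def fps_zero_def)
next
  case False
  define N where "N = fps_const (1 / \<delta>) * moment_series d t i"
  have "N * knot_factor e * W = fps_const (1 / \<delta>) * (moment_series d t i * knot_factor e * W)"
    by (simp add: N_def mult_ac)
  then have "N * knot_factor e * W = fps_const \<kappa>" using False unfolding series by simp
  moreover have "of_nat ((k + d + 2) choose k) * ((moment d t i (k + 1) - e * moment d t i k) / \<delta>)
    = fps_nth (fps_const (1 / (real d + 2)) * (knot_factor e * fps_deriv N) - fps_const e * N) k" for k
  proof -
    define b c where "b = real ((k + d + 2) choose k)" and "c = real ((k + d + 1) choose k)"
    \<comment> \<open>The two absorption identities express the weights of degree \<open>d\<close>,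
      at orders \<open>k + 1\<close> and \<open>k\<close>, through the weight \<open>b\<close> of
      degree \<open>d + 1\<close> at order \<open>k\<close>.\<close>
    have "(k + 1) * ((k + d + 2) choose (k + 1)) = (d + 2) * ((k + d + 2) choose k)"
      using binomial_absorb_comp[of "k + d + 2" k] Suc_times_binomial_eq[of "k + d + 1" k] by simp
    then have b1: "real (k + 1) * real ((k + d + 2) choose (k + 1)) = real (d + 2) * b"
      unfolding b_def by (metis of_nat_mult)
    have "k * ((k + d + 1) choose k) + (d + 2) * ((k + d + 1) choose k) = (d + 2) * ((k + d + 2) choose k)"
      using binomial_absorb_comp[of "k + d + 2" k] by (simp add: algebra_simps)
    then have b2: "real k * c + real (d + 2) * c = real (d + 2) * b"
      unfolding b_def c_def by (metis of_nat_mult of_nat_add)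
    have "fps_nth (knot_factor e * fps_deriv N) k
      = fps_nth (fps_deriv N) k - e * (real k * fps_nth N k)"
      by (cases k) (simp_all add: knot_factor_def left_diff_distrib mult.assoc)
    also have "fps_nth (fps_deriv N) k = real (d + 2) * b * moment d t i (k + 1) / \<delta>"
    proof -
      have "fps_nth N (k + 1) = real ((k + d + 2) choose (k + 1)) * moment d t i (k + 1) / \<delta>"
        by (simp add: N_def moment_series_def del: binomial_Suc_Suc)
      then have "fps_nth (fps_deriv N) k
          = real (k + 1) * real ((k + d + 2) choose (k + 1)) * moment d t i (k + 1) / \<delta>"
        by (simp only: fps_deriv_nth of_nat_Suc Suc_eq_plus1 mult.assoc times_divide_eq_right)
      then show ?thesis unfolding b1 .
    qed
    also have "real (d + 2) * b * moment d t i (k + 1) / \<delta> - e * (real k * fps_nth N k)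
        = (real (d + 2) * b * moment d t i (k + 1) - e * real k * c * moment d t i k) / \<delta>"
      by (simp add: N_def moment_series_def c_def diff_divide_distrib)
    finally have "fps_nth (fps_const (1 / (real d + 2)) * (knot_factor e * fps_deriv N) - fps_const e * N) k
      = (real (d + 2) * b * moment d t i (k + 1) - e * real k * c * moment d t i k) / \<delta> / (real d + 2)
        - e * (c * moment d t i k / \<delta>)"
      by (simp add: N_def moment_series_def c_def)
    also have "\<dots> = (real (d + 2) * b * moment d t i (k + 1)
        - e * (real k * c + real (d + 2) * c) * moment d t i k) / \<delta> / (real d + 2)"
      using False by (simp add: divide_simps) (simp add: algebra_simps)
    also have "\<dots> = b * ((moment d t i (k + 1) - e * moment d t i k) / \<delta>)"
      unfolding b2 using False by (simp add: divide_simps) (simp add: algebra_simps)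
    finally show ?thesis by (simp add: b_def)
  qed
  ultimately show ?thesis by (intro exI[of _ N]) (auto intro!: fps_ext)
qed

text \<open>The Curry--Schoenberg moment formula, as a generating function.\<close>

lemma moment_series_knots:
  assumes "mono_on {i..i + d + 1} t"
  shows "moment_series d t i * (\<Prod>j\<in>{i..i + d + 1}. knot_factor (t j))
    = fps_const ((t (i + d + 1) - t i) / (real d + 1))"
  using assms
proof (induction d arbitrary: i)
  case 0
  have "{i..i + 0 + 1} = {i, i + 1}" by auto
  moreover have "t i \<le> t (i + 1)" using 0 by (auto intro: mono_onD)
  ultimately show ?case using moment_series_0[of t i] by simp
next
  case (Suc d)
  \<comment> \<open>The knots shared by the two lower-degree splines; each spline has just one knot
    factor besides \<open>W\<close>.\<close>
  define W where "W = (\<Prod>j\<in>{i + 1..i + d + 1}. knot_factor (t j))"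
  define l where "l = i + d + 2"
  define K where "K = 1 / (real d + 1)"
  have mono: "mono_on {i..i + d + 1} t" "mono_on {i + 1..i + 1 + d + 1} t"
    using Suc.prems by (auto intro: mono_on_subset)
  have split: "{i..i + d + 1} = insert i {i + 1..i + d + 1}"
    "{i + 1..i + 1 + d + 1} = insert l {i + 1..i + d + 1}"
    "{i..i + Suc d + 1} = insert i (insert l {i + 1..i + d + 1})"
    by (auto simp: l_def)
  have l: "l \<notin> {i + 1..i + d + 1}" "i \<notin> {i + 1..i + d + 1}" "i \<noteq> l" by (auto simp: l_def)
  have prods: "(\<Prod>j\<in>{i..i + d + 1}. knot_factor (t j)) = knot_factor (t i) * W"
    "(\<Prod>j\<in>{i + 1..i + 1 + d + 1}. knot_factor (t j)) = knot_factor (t l) * W"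
    "(\<Prod>j\<in>{i..i + Suc d + 1}. knot_factor (t j)) = knot_factor (t i) * (knot_factor (t l) * W)"
    unfolding split W_def using l by (simp_all del: atLeastAtMost_iff)
  have const: "W = knot_factor e ^ (d + 1)" if "\<And>j. j \<in> {i + 1..i + d + 1} \<Longrightarrow> t j = e" for e
  proof -
    have "W = (\<Prod>j\<in>{i + 1..i + d + 1}. knot_factor e)"
      unfolding W_def by (rule prod.cong) (use that in auto)
    then show ?thesis by simp
  qed
  have "moment_series d t i * knot_factor (t i) * W = fps_const ((t (i + d + 1) - t i) * K)"
    using Suc.IH[OF mono(1)] unfolding prods by (simp add: K_def mult.assoc)
  moreover have "W = knot_factor (t i) ^ (d + 1)" if "t (i + d + 1) - t i = 0"
  proof (rule const)
    fix j assume "j \<in> {i + 1..i + d + 1}"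
    then show "t j = t i"
      using mono_onD[OF mono(1), of i j] mono_onD[OF mono(1), of j "i + d + 1"] that by auto
  qed
  ultimately obtain N1 where N1: "N1 * knot_factor (t i) * W = fps_const K"
    "Abs_fps (\<lambda>k. of_nat ((k + d + 2) choose k) *
        ((moment d t i (k + 1) - t i * moment d t i k) / (t (i + d + 1) - t i)))
      = fps_const (1 / (real d + 2)) * (knot_factor (t i) * fps_deriv N1) - fps_const (t i) * N1"
    using moment_term by blast
  have "moment_series d t (i + 1) * knot_factor (t l) * W = fps_const ((t l - t (i + 1)) * K)"
    using Suc.IH[OF mono(2)] unfolding prods by (simp add: K_def mult.assoc l_def)
  moreover have "W = knot_factor (t l) ^ (d + 1)" if "t l - t (i + 1) = 0"
  proof (rule const)
    fix j assume "j \<in> {i + 1..i + d + 1}"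
    then show "t j = t l"
      using mono_onD[OF mono(2), of "i + 1" j] mono_onD[OF mono(2), of j l] that by (auto simp: l_def)
  qed
  ultimately obtain N2 where N2: "N2 * knot_factor (t l) * W = fps_const K"
    "Abs_fps (\<lambda>k. of_nat ((k + d + 2) choose k) *
        ((moment d t (i + 1) (k + 1) - t l * moment d t (i + 1) k) / (t l - t (i + 1))))
      = fps_const (1 / (real d + 2)) * (knot_factor (t l) * fps_deriv N2) - fps_const (t l) * N2"
    using moment_term by blast
  have "moment_series (Suc d) t i = Abs_fps (\<lambda>k. of_nat ((k + d + 2) choose k) *
        ((moment d t i (k + 1) - t i * moment d t i k) / (t (i + d + 1) - t i)))
    - Abs_fps (\<lambda>k. of_nat ((k + d + 2) choose k) *
        ((moment d t (i + 1) (k + 1) - t l * moment d t (i + 1) k) / (t l - t (i + 1))))"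
    by (rule fps_ext) (simp add: moment_series_def moment_Suc l_def algebra_simps diff_divide_distrib)
  then have series: "moment_series (Suc d) t i =
      fps_const (1 / (real d + 2)) * (knot_factor (t i) * fps_deriv N1 - knot_factor (t l) * fps_deriv N2)
      + (fps_const (t l) * N2 - fps_const (t i) * N1)"
    unfolding N1 N2 by (simp add: algebra_simps)
  \<comment> \<open>Cancelling \<open>W\<close> identifies \<open>N1\<close> and \<open>N2\<close>
    times their own end factors. The derivative of this identity removes all derivatives from the
    formula for the series.\<close>
  have "W \<noteq> 0" unfolding W_def by (simp add: knot_factor_nonzero)
  with N1(1) N2(1) have common: "N1 * knot_factor (t i) = N2 * knot_factor (t l)"
    by (metis mult_right_cancel)
  then have "fps_deriv (N1 * knot_factor (t i)) = fps_deriv (N2 * knot_factor (t l))" by simp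
  then have deriv: "knot_factor (t i) * fps_deriv N1 - knot_factor (t l) * fps_deriv N2
    = - (fps_const (t l) * N2 - fps_const (t i) * N1)"
    by (simp add: fps_deriv_knot_factor algebra_simps flip: fps_const_neg)
  have "fps_const q * - X + X = fps_const (1 - q) * X" for q :: real and X
    by (simp add: algebra_simps flip: fps_const_sub)
  then have "moment_series (Suc d) t i
      = fps_const (1 - 1 / (real d + 2)) * (fps_const (t l) * N2 - fps_const (t i) * N1)"
    unfolding series deriv .
  moreover have "c * (A * N2 - C * N1) * (u * (v * W)) = c * (A * u * (N2 * v * W) - C * v * (N1 * u * W))"
    for c A C u v :: "real fps"
    by (simp add: algebra_simps)
  ultimately have "moment_series (Suc d) t i * (knot_factor (t i) * (knot_factor (t l) * W))
      = fps_const (1 - 1 / (real d + 2)) *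
        (fps_const (t l) * knot_factor (t i) * fps_const K
         - fps_const (t i) * knot_factor (t l) * fps_const K)"
    by (simp only: N1 N2)
  also have "\<dots> = fps_const (1 - 1 / (real d + 2)) * fps_const K *
      (fps_const (t l) * knot_factor (t i) - fps_const (t i) * knot_factor (t l))"
    by (simp only: right_diff_distrib mult_ac)
  also have "fps_const (t l) * knot_factor (t i) - fps_const (t i) * knot_factor (t l)
      = fps_const (t l - t i)"
    by (simp add: knot_factor_def algebra_simps flip: fps_const_sub)
  also have "fps_const (1 - 1 / (real d + 2)) * fps_const K * fps_const (t l - t i)
      = fps_const ((1 - 1 / (real d + 2)) * K * (t l - t i))"
    by simp
  also have "(1 - 1 / (real d + 2)) * K * (t l - t i) = (t l - t i) / (real (Suc d) + 1)"
    by (simp add: K_def divide_simps) (simp add: algebra_simps)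
  finally show ?case unfolding prods by (simp add: l_def)
qed

section \<open>B-splines on proper knot vectors\<close>

definition proper_knots :: "nat \<Rightarrow> real list \<Rightarrow> bool" where
  "proper_knots d x \<longleftrightarrow> length x = d + 2 \<and> sorted x \<and> hd x < last x"

lemma proper_knotsD:
  assumes "proper_knots d x"
  shows "length x = d + 2" "sorted x" "hd x < last x" "x \<noteq> []" "x ! 0 = hd x" "x ! (d + 1) = last x"
    "mono_on {0..d + 1} ((!) x)" "\<And>s. bspline x s = cox_de_boor d ((!) x) 0 s"
proof -
  show len: "length x = d + 2" and "sorted x" "hd x < last x"
    using assms by (simp_all add: proper_knots_def)
  then show "x \<noteq> []" by auto
  then show "x ! 0 = hd x" "x ! (d + 1) = last x"
    using len by (simp_all add: hd_conv_nth last_conv_nth)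
  show "mono_on {0..d + 1} ((!) x)"
    using \<open>sorted x\<close> len by (auto intro!: mono_onI sorted_nth_mono)
  show "bspline x s = cox_de_boor d ((!) x) 0 s" for s
    using len by (simp add: bspline_def)
qed

lemma sorted_hd_le: "sorted x \<Longrightarrow> a \<in> set x \<Longrightarrow> hd x \<le> a"
  by (cases x) auto

lemma sorted_le_last: "sorted x \<Longrightarrow> a \<in> set x \<Longrightarrow> a \<le> last x"
  by (induction x) auto

lemma bspline_outside:
  assumes "proper_knots d x" "s < hd x \<or> last x \<le> s"
  shows "bspline x s = 0"
  using cox_de_boor_outside[of 0 d "(!) x" s] assms proper_knotsD[OF assms(1)] by simp

lemma bspline_pos:
  assumes x: "proper_knots d x" and s: "hd x < s" "s < last x" "s \<notin> set x"
  shows "0 < bspline x s"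
proof -
  note x' = proper_knotsD[OF x]
  have "s < x ! (d + 1)" "\<not> s < x ! 0" using s x' by auto
  from ex_least_nat_less[of "\<lambda>j. s < x ! j", OF this]
  obtain j where j: "j < d + 1" "\<not> s < x ! j" "s < x ! Suc j" by auto
  have "s \<noteq> x ! j" using s(3) j(1) x'(1) by auto
  with j show ?thesis
    unfolding x'(8) using x'(7) by (intro cox_de_boor_pos[of 0 d _ j]) auto
qed

lemma bspline_nonzero:
  assumes x: "proper_knots d x"
  obtains s where "bspline x s \<noteq> 0"
proof -
  have "infinite ({hd x<..<last x} - set x)"
    using proper_knotsD(3)[OF x] by (intro Diff_infinite_finite infinite_Ioo) auto
  then obtain s where "s \<in> {hd x<..<last x} - set x" using infinite_imp_nonempty by blast
  then show ?thesis using bspline_pos[OF x, of s] that by force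
qed

text \<open>In a gap between the ranges of \<open>y\<close> and \<open>z\<close> the right-hand side
  would vanish, whereas the spline of \<open>x\<close> is positive there away from its
  knots.\<close>

lemma bspline_ranges_touch:
  assumes x: "proper_knots d x" and y: "proper_knots d y" and z: "proper_knots d z"
    and eq: "\<And>s. bspline x s = a * bspline y s + b * bspline z s"
    and "hd x = hd y" "last x = last z"
  shows "hd z \<le> last y"
proof (rule ccontr)
  assume "\<not> ?thesis"
  then have "infinite ({last y<..<hd z} - set x)"
    by (intro Diff_infinite_finite infinite_Ioo) auto
  then obtain s where "s \<in> {last y<..<hd z} - set x" using infinite_imp_nonempty by blast
  moreover from this have "0 < bspline x s"
    using proper_knotsD(3)[OF y] proper_knotsD(3)[OF z] assms by (intro bspline_pos[OF x]) auto
  ultimately show False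
    using eq[of s] bspline_outside[OF y, of s] bspline_outside[OF z, of s] by simp
qed

section \<open>Recovering the knots from the spline\<close>

lemma prod_knot_factor:
  "(\<Prod>j\<in>{0..<length x}. knot_factor (x ! j)) = fps_of_poly (\<Prod>a\<leftarrow>x. [:1, - a:])"
proof -
  have "fps_of_poly (\<Prod>a\<leftarrow>x. [:1, - a:]) = (\<Prod>a\<leftarrow>x. knot_factor a)"
    by (simp add: fps_of_poly_prod_list o_def knot_factor_def fps_of_poly_pCons algebra_simps
        flip: fps_const_neg)
  also have "\<dots> = (\<Prod>j\<in>{0..<length x}. knot_factor (x ! j))"
    by (simp add: prod.list_conv_set_nth)
  finally show ?thesis ..
qed

text \<open>A zero knot contributes the factor 1 and is invisible in the product; the common length
  accounts for it. Reversing the polynomials turns the knots themselves into roots, and the reversed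
  polynomials agree at every nonzero point.\<close>

lemma mset_eq_of_knot_polys:
  assumes eq: "(\<Prod>a\<leftarrow>x. [:1, - a:]) = (\<Prod>a\<leftarrow>y. [:1, - a :: real:])"
    and len: "length x = length y"
  shows "mset x = mset y"
proof -
  define q where "q x = (\<Prod>a\<leftarrow>x. [:- a, 1 :: real:])" for x
  have scale: "poly (q x) w = w ^ length x * poly (\<Prod>a\<leftarrow>x. [:1, - a:]) (1 / w)" if "w \<noteq> 0" for x w
    unfolding q_def using that by (induction x) (auto simp: field_simps)
  have "q x = q y"
  proof (rule ccontr)
    assume "q x \<noteq> q y"
    then have "finite {w. poly (q x - q y) w = 0}" by (intro poly_roots_finite) simp
    moreover have "UNIV - {0} \<subseteq> {w. poly (q x - q y) w = 0}"
      using scale[of _ x] scale[of _ y] eq len by auto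
    ultimately have "finite (UNIV - {0 :: real})" by (rule rev_finite_subset)
    then show False by (simp add: infinite_UNIV_char_0)
  qed
  moreover have "proots (q x) = mset x" for x
  proof (induction x)
    case (Cons a x)
    have "q x \<noteq> 0" by (auto simp: q_def prod_list_zero_iff)
    then have "[:- a, 1:] * q x \<noteq> 0" by (simp only: mult_eq_0_iff) simp
    moreover have "q (a # x) = [:- a, 1:] * q x" by (simp add: q_def)
    ultimately show ?case using Cons by (simp add: proots_mult del: mult_pCons_left)
  qed (simp add: q_def)
  ultimately show ?thesis by metis
qed

text \<open>The moments determine the polynomial whose roots are the reciprocals of the nonzero knots.\<close>

lemma bspline_proportional_imp_eq:
  assumes x: "proper_knots d x" and y: "proper_knots d y"
    and eq: "\<And>s. bspline x s = c * bspline y s"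
  shows "x = y"
proof -
  define P where "P x = (\<Prod>a\<leftarrow>x. [:1, - a :: real:])" for x
  define C where "C x = (last x - hd x) / (real d + 1)" for x
  have series: "moment_series d ((!) x) 0 * fps_of_poly (P x) = fps_const (C x)" if "proper_knots d x" for x
  proof -
    note x = proper_knotsD[OF that]
    have "{0..0 + d + 1} = {0..<length x}" using x(1) by auto
    then show ?thesis
      using moment_series_knots[of 0 d "(!) x"] x(5-7)
      by (simp add: P_def C_def prod_knot_factor)
  qed
  have "moment d ((!) x) 0 k = c * moment d ((!) y) 0 k" for k
    using eq unfolding moment_def proper_knotsD(8)[OF x] proper_knotsD(8)[OF y]
    by (simp add: mult.left_commute)
  then have "moment_series d ((!) x) 0 = fps_const c * moment_series d ((!) y) 0"
    by (intro fps_ext) (simp add: moment_series_def)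
  then have "fps_const (C x) * fps_of_poly (P y)
    = fps_const c * (moment_series d ((!) y) 0 * fps_of_poly (P y)) * fps_of_poly (P x)"
    unfolding series[OF x, symmetric] by (simp add: mult_ac)
  then have main: "fps_const (C x) * fps_of_poly (P y) = fps_const (c * C y) * fps_of_poly (P x)"
    unfolding series[OF y] by simp
  \<comment> \<open>Comparing constant terms in \<open>main\<close> identifies the two constants.
    They are nonzero because the knot range is nondegenerate, so they cancel.\<close>
  have "coeff (P x) 0 = 1" for x
    unfolding P_def by (induction x) (simp_all add: coeff_mult)
  then have "C x = c * C y"
    using arg_cong[OF main, of "\<lambda>f. fps_nth f 0"] by simp
  moreover have "C x \<noteq> 0" using proper_knotsD(3)[OF x] by (simp add: C_def)
  ultimately have "P y = P x" using main by (simp add: fps_of_poly_eq_iff)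
  then have "mset x = mset y"
    using proper_knotsD(1)[OF x] proper_knotsD(1)[OF y]
    by (intro mset_eq_of_knot_polys) (simp_all add: P_def)
  then show ?thesis
    using proper_knotsD(2)[OF x] proper_knotsD(2)[OF y] properties_for_sort by metis
qed

section \<open>Multiplicities of the end knots\<close>

lemma sorted_decomp_hd:
  assumes "sorted x" "\<forall>z\<in>set x. a \<le> z"
  shows "x = replicate (count_list x a) a @ filter (\<lambda>z. a < z) x"
  using assms
proof (induction x)
  case (Cons z zs)
  show ?case
  proof (cases "z = a")
    case False
    with Cons.prems have "a < z" "\<forall>w\<in>set zs. a < w" by force+
    then have "a \<notin> set zs" "filter (\<lambda>z. a < z) zs = zs" by auto
    with \<open>a < z\<close> show ?thesis by (simp add: count_notin)
  qed (use Cons in auto)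
qed simp

lemma sorted_decomp_last:
  assumes "sorted x" "\<forall>z\<in>set x. z \<le> b"
  shows "x = filter (\<lambda>z. z < b) x @ replicate (count_list x b) b"
  using assms
proof (induction x)
  case (Cons z zs)
  show ?case
  proof (cases "z = b")
    case True
    with Cons.prems have "\<forall>w\<in>set zs. w = b" by force
    then have "zs = replicate (length zs) b" "filter (\<lambda>z. z < b) zs = []"
      by (auto simp: replicate_length_same)
    moreover from this have "count_list zs b = length zs"
      using \<open>\<forall>w\<in>set zs. w = b\<close> by (simp add: count_list_eq_length_filter filter_id_conv)
    ultimately show ?thesis using True by simp
  qed (use Cons in auto)
qed simp

text \<open>Translates \<open>count_list\<close> into the index conditions of
  \<open>cox_de_boor_start\<close>. The bound \<open>d + 1\<close> holds because the last knot
  differs from the first.\<close>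

lemma knots_start:
  assumes "proper_knots d x" and m: "m = count_list x (hd x)"
  shows "1 \<le> m" "m \<le> d + 1" "\<And>j. j < m \<Longrightarrow> x ! j = hd x" "hd x < x ! m"
proof -
  note x = proper_knotsD[OF assms(1)]
  define r where "r = filter (\<lambda>z. hd x < z) x"
  have decomp: "x = replicate m (hd x) @ r"
    unfolding r_def m by (rule sorted_decomp_hd[OF x(2)]) (simp add: sorted_hd_le x(2))
  show "1 \<le> m" unfolding m using count_list_0_iff[of x "hd x"] x(4) by (simp add: Suc_le_eq)
  have "last x \<in> set r" using x(3,4) by (simp add: r_def)
  then have r: "r \<noteq> []" by auto
  have "length x = m + length r" by (subst decomp) simp
  with r show "m \<le> d + 1" unfolding x(1) by (cases r) auto
  show "x ! j = hd x" if "j < m" for j by (subst decomp) (simp add: that nth_append)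
  have "x ! m = r ! 0" by (subst decomp) (simp add: nth_append)
  moreover have "r ! 0 \<in> set r" using r by simp
  ultimately show "hd x < x ! m" by (auto simp: r_def)
qed

lemma knots_end:
  assumes "proper_knots d x" and m: "m = count_list x (last x)"
  shows "1 \<le> m" "m \<le> d + 1" "\<And>j. j < m \<Longrightarrow> x ! (d + 1 - j) = last x" "x ! (d + 1 - m) < last x"
proof -
  note x = proper_knotsD[OF assms(1)]
  define r where "r = filter (\<lambda>z. z < last x) x"
  have decomp: "x = r @ replicate m (last x)"
    unfolding r_def m by (rule sorted_decomp_last[OF x(2)]) (simp add: sorted_le_last x(2))
  show "1 \<le> m" unfolding m using count_list_0_iff[of x "last x"] x(4) by (simp add: Suc_le_eq)
  have "hd x \<in> set r" using x(3,4) by (simp add: r_def)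
  then have r: "r \<noteq> []" by auto
  have len: "d + 2 = length r + m" by (subst x(1)[symmetric], subst decomp) simp
  with r show "m \<le> d + 1" by (cases r) auto
  show "x ! (d + 1 - j) = last x" if "j < m" for j
    by (subst decomp) (use that len in \<open>auto simp: nth_append\<close>)
  have less: "d + 1 - m < length r" using len \<open>m \<le> d + 1\<close> by simp
  have "x ! (d + 1 - m) = r ! (d + 1 - m)" by (subst decomp) (use less in \<open>simp add: nth_append\<close>)
  moreover have "r ! (d + 1 - m) \<in> set r" using less by simp
  ultimately show "x ! (d + 1 - m) < last x" by (auto simp: r_def)
qed

lemma bspline_start:
  assumes "proper_knots d x"
  shows "\<exists>c>0. ((\<lambda>s. bspline x s / (s - hd x) ^ (d + 1 - count_list x (hd x))) \<longlongrightarrow> c) (at_right (hd x))"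
  unfolding proper_knotsD(8)[OF assms]
  by (rule cox_de_boor_start) (use proper_knotsD[OF assms] knots_start[OF assms refl] in auto)

lemma bspline_end:
  assumes "proper_knots d x"
  shows "\<exists>c>0. ((\<lambda>s. bspline x s / (last x - s) ^ (d + 1 - count_list x (last x))) \<longlongrightarrow> c) (at_left (last x))"
  unfolding proper_knotsD(8)[OF assms]
  by (rule cox_de_boor_end) (use proper_knotsD[OF assms] knots_end[OF assms refl] in auto)

section \<open>Leading terms at the ends\<close>

text \<open>Dominance at the left end: among splines of one degree with a common start, a higher
  multiplicity means a lower order of vanishing there.\<close>

definition starts_before :: "real list \<Rightarrow> real list \<Rightarrow> bool" where
  "starts_before x y \<longleftrightarrow>
     hd x < hd y \<or> hd x = hd y \<and> count_list y (hd y) \<le> count_list x (hd x)"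

definition ends_after :: "real list \<Rightarrow> real list \<Rightarrow> bool" where
  "ends_after x y \<longleftrightarrow>
     last y < last x \<or> last x = last y \<and> count_list y (last y) \<le> count_list x (last x)"

definition first_starting :: "('i \<Rightarrow> real list) \<Rightarrow> 'i set \<Rightarrow> 'i set" where
  "first_starting xs J = {j \<in> J. \<forall>i\<in>J. starts_before (xs j) (xs i)}"

definition last_ending :: "('i \<Rightarrow> real list) \<Rightarrow> 'i set \<Rightarrow> 'i set" where
  "last_ending xs J = {j \<in> J. \<forall>i\<in>J. ends_after (xs j) (xs i)}"

lemma total_preorder_least:
  assumes "finite J" "J \<noteq> {}" "\<And>i j. R i j \<or> R j i" "\<And>i j k. R i j \<Longrightarrow> R j k \<Longrightarrow> R i k"
  shows "\<exists>j\<in>J. \<forall>i\<in>J. R j i"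
  using assms(1,2)
proof (induction J rule: finite_ne_induct)
  case (singleton j)
  then show ?case using assms(3) by blast
next
  case (insert k J)
  then obtain j where "j \<in> J" "\<forall>i\<in>J. R j i" by blast
  then show ?case using assms(3)[of j k] assms(3)[of k k] assms(4) by (metis insert_iff)
qed

lemma first_starting_nonempty:
  assumes "finite J" "J \<noteq> {}"
  shows "first_starting xs J \<noteq> {}"
  using total_preorder_least[OF assms, of "\<lambda>i j. starts_before (xs i) (xs j)"]
  by (force simp: first_starting_def starts_before_def)

lemma last_ending_nonempty:
  assumes "finite J" "J \<noteq> {}"
  shows "last_ending xs J \<noteq> {}"
  using total_preorder_least[OF assms, of "\<lambda>i j. ends_after (xs i) (xs j)"]
  by (force simp: last_ending_def ends_after_def)

text \<open>The weights are the leading coefficients of the functions at an end of the union of their supports.\<close>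

definition leading_weights :: "'i set \<Rightarrow> 'i set \<Rightarrow> ('i \<Rightarrow> real \<Rightarrow> real) \<Rightarrow> ('i \<Rightarrow> real) \<Rightarrow> bool" where
  "leading_weights J L f w \<longleftrightarrow>
     (\<forall>j\<in>L. w j > 0) \<and> (\<forall>j\<in>J - L. w j = 0) \<and>
     (\<forall>c. (\<forall>s. (\<Sum>j\<in>J. c j * f j s) = 0) \<longrightarrow> (\<Sum>j\<in>J. c j * w j) = 0)"

text \<open>A relation between the functions is divided by the gauge \<open>g\<close> and passed to
  the limit along \<open>F\<close>; the weights are the limits of the quotients.\<close>

lemma leading_weights_of_limits:
  assumes "F \<noteq> bot"
    and "\<And>j. j \<in> J \<Longrightarrow> \<exists>c. ((\<lambda>s. f j s / g s) \<longlongrightarrow> c) F \<and> (if j \<in> L then c > 0 else c = 0)"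
    and "L \<subseteq> J"
  shows "\<exists>w. leading_weights J L f w"
proof -
  from assms(2) obtain w where w:
    "\<And>j. j \<in> J \<Longrightarrow> ((\<lambda>s. f j s / g s) \<longlongrightarrow> w j) F \<and> (if j \<in> L then w j > 0 else w j = 0)"
    by metis
  have "(\<Sum>j\<in>J. c j * w j) = 0" if "\<forall>s. (\<Sum>j\<in>J. c j * f j s) = 0" for c
  proof (rule tendsto_unique[OF assms(1)])
    show "((\<lambda>s. \<Sum>j\<in>J. c j * (f j s / g s)) \<longlongrightarrow> (\<Sum>j\<in>J. c j * w j)) F"
      using w by (intro tendsto_intros) auto
    have "(\<lambda>s. \<Sum>j\<in>J. c j * (f j s / g s)) = (\<lambda>s. (\<Sum>j\<in>J. c j * f j s) / g s)"
      by (simp add: sum_divide_distrib)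
    then show "((\<lambda>s. \<Sum>j\<in>J. c j * (f j s / g s)) \<longlongrightarrow> 0) F" using that by simp
  qed
  then show ?thesis using w assms(3) unfolding leading_weights_def by (intro exI[of _ w]) auto
qed

lemma start_weights:
  assumes "finite J" and xs: "\<And>j. j \<in> J \<Longrightarrow> proper_knots d (xs j)"
  shows "\<exists>w. leading_weights J (first_starting xs J) (\<lambda>j. bspline (xs j)) w"
proof (cases "J = {}")
  case True
  then show ?thesis by (simp add: leading_weights_def first_starting_def)
next
  case False
  then obtain l where l: "l \<in> J" "\<And>j. j \<in> J \<Longrightarrow> starts_before (xs l) (xs j)"
    using first_starting_nonempty[OF assms(1), of xs] by (auto simp: first_starting_def)
  define a where "a = hd (xs l)"
  \<comment> \<open>The lowest order of vanishing at \<open>a\<close> that occurs in the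
    family.\<close>
  define e where "e = d + 1 - count_list (xs l) a"
  show ?thesis
  proof (rule leading_weights_of_limits[where F = "at_right a" and g = "\<lambda>s. (s - a) ^ e"])
    fix j assume j: "j \<in> J"
    define m where "m = count_list (xs j) (hd (xs j))"
    show "\<exists>c. ((\<lambda>s. bspline (xs j) s / (s - a) ^ e) \<longlongrightarrow> c) (at_right a) \<and>
      (if j \<in> first_starting xs J then c > 0 else c = 0)"
    proof (cases "hd (xs j) = a")
      case True
      from bspline_start[OF xs[OF j]] obtain c where c: "c > 0"
        "((\<lambda>s. bspline (xs j) s / (s - a) ^ (d + 1 - m)) \<longlongrightarrow> c) (at_right a)"
        unfolding m_def True by blast
      show ?thesis
      proof (cases "m = count_list (xs l) a")
        case eq: True
        then have "j \<in> first_starting xs J"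
          using l j True by (auto simp: first_starting_def starts_before_def m_def a_def)
        with c eq show ?thesis by (auto simp: e_def)
      next
        case False
        \<comment> \<open>The surplus order of vanishing: a positive power of \<open>s - a\<close>
          is left over and forces the limit zero.\<close>
        define k where "k = count_list (xs l) a - m"
        have less: "m < count_list (xs l) a"
          using l(2)[OF j] False True by (simp add: starts_before_def m_def a_def)
        then have nin: "j \<notin> first_starting xs J"
          using l True by (auto simp: first_starting_def starts_before_def m_def a_def)
        have "count_list (xs l) a \<le> d + 1"
          using knots_start(2)[OF xs[OF l(1)] refl] by (simp add: a_def)
        then have e: "d + 1 - m = e + k" and "0 < k" using less by (auto simp: e_def k_def)
        have "((\<lambda>s. (s - a) ^ k) \<longlongrightarrow> (a - a) ^ k) (at_right a)" by (intro tendsto_intros)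
        then have "((\<lambda>s. (s - a) ^ k) \<longlongrightarrow> 0) (at_right a)" using \<open>0 < k\<close> by (simp add: power_0_left)
        from tendsto_mult[OF c(2) this]
        have "((\<lambda>s. bspline (xs j) s / (s - a) ^ (e + k) * (s - a) ^ k) \<longlongrightarrow> 0) (at_right a)"
          unfolding e by simp
        then have "((\<lambda>s. bspline (xs j) s / (s - a) ^ e) \<longlongrightarrow> 0) (at_right a)"
          by (rule Lim_transform_eventually, intro eventually_mono[OF eventually_at_right_less])
            (auto simp: power_add)
        with nin show ?thesis by auto
      qed
    next
      case False
      then have gt: "a < hd (xs j)" using l(2)[OF j] by (auto simp: starts_before_def a_def)
      then have "j \<notin> first_starting xs J"
        using l(1) by (force simp: first_starting_def starts_before_def a_def)
      moreover have "eventually (\<lambda>s. 0 = bspline (xs j) s / (s - a) ^ e) (at_right a)"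
        using eventually_at_right_real[OF gt]
        by (rule eventually_mono) (simp add: bspline_outside[OF xs[OF j]])
      then have "((\<lambda>s. bspline (xs j) s / (s - a) ^ e) \<longlongrightarrow> 0) (at_right a)"
        by (rule Lim_transform_eventually[OF tendsto_const])
      ultimately show ?thesis by auto
    qed
  qed (auto simp: first_starting_def)
qed

lemma end_weights:
  assumes "finite J" and xs: "\<And>j. j \<in> J \<Longrightarrow> proper_knots d (xs j)"
  shows "\<exists>w. leading_weights J (last_ending xs J) (\<lambda>j. bspline (xs j)) w"
proof (cases "J = {}")
  case True
  then show ?thesis by (simp add: leading_weights_def last_ending_def)
next
  case False
  then obtain l where l: "l \<in> J" "\<And>j. j \<in> J \<Longrightarrow> ends_after (xs l) (xs j)"
    using last_ending_nonempty[OF assms(1), of xs] by (auto simp: last_ending_def)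
  define a where "a = last (xs l)"
  define e where "e = d + 1 - count_list (xs l) a"
  show ?thesis
  proof (rule leading_weights_of_limits[where F = "at_left a" and g = "\<lambda>s. (a - s) ^ e"])
    fix j assume j: "j \<in> J"
    define m where "m = count_list (xs j) (last (xs j))"
    show "\<exists>c. ((\<lambda>s. bspline (xs j) s / (a - s) ^ e) \<longlongrightarrow> c) (at_left a) \<and>
      (if j \<in> last_ending xs J then c > 0 else c = 0)"
    proof (cases "last (xs j) = a")
      case True
      from bspline_end[OF xs[OF j]] obtain c where c: "c > 0"
        "((\<lambda>s. bspline (xs j) s / (a - s) ^ (d + 1 - m)) \<longlongrightarrow> c) (at_left a)"
        unfolding m_def True by blast
      show ?thesis
      proof (cases "m = count_list (xs l) a")
        case eq: True
        then have "j \<in> last_ending xs J"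
          using l j True by (auto simp: last_ending_def ends_after_def m_def a_def)
        with c eq show ?thesis by (auto simp: e_def)
      next
        case False
        define k where "k = count_list (xs l) a - m"
        have less: "m < count_list (xs l) a"
          using l(2)[OF j] False True by (simp add: ends_after_def m_def a_def)
        then have nin: "j \<notin> last_ending xs J"
          using l True by (auto simp: last_ending_def ends_after_def m_def a_def)
        have "count_list (xs l) a \<le> d + 1"
          using knots_end(2)[OF xs[OF l(1)] refl] by (simp add: a_def)
        then have e: "d + 1 - m = e + k" and "0 < k" using less by (auto simp: e_def k_def)
        have "((\<lambda>s. (a - s) ^ k) \<longlongrightarrow> (a - a) ^ k) (at_left a)" by (intro tendsto_intros)
        then have "((\<lambda>s. (a - s) ^ k) \<longlongrightarrow> 0) (at_left a)" using \<open>0 < k\<close> by (simp add: power_0_left)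
        from tendsto_mult[OF c(2) this]
        have "((\<lambda>s. bspline (xs j) s / (a - s) ^ (e + k) * (a - s) ^ k) \<longlongrightarrow> 0) (at_left a)"
          unfolding e by simp
        then have "((\<lambda>s. bspline (xs j) s / (a - s) ^ e) \<longlongrightarrow> 0) (at_left a)"
          by (rule Lim_transform_eventually)
            (auto simp: power_add eventually_at_filter)
        with nin show ?thesis by auto
      qed
    next
      case False
      then have gt: "last (xs j) < a" using l(2)[OF j] by (auto simp: ends_after_def a_def)
      then have "j \<notin> last_ending xs J"
        using l(1) by (force simp: last_ending_def ends_after_def a_def)
      moreover have "eventually (\<lambda>s. 0 = bspline (xs j) s / (a - s) ^ e) (at_left a)"
        using eventually_at_left_real[OF gt]
        by (rule eventually_mono) (simp add: bspline_outside[OF xs[OF j]])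
      then have "((\<lambda>s. bspline (xs j) s / (a - s) ^ e) \<longlongrightarrow> 0) (at_left a)"
        by (rule Lim_transform_eventually[OF tendsto_const])
      ultimately show ?thesis by auto
    qed
  qed (auto simp: last_ending_def)
qed

section \<open>Splits of a mesh with constant splits\<close>

lemma axis_segment_subset_iff:
  assumes "a < b"
  shows "axis_segment k t a b \<subseteq> axis_segment k' t' a' b' \<longleftrightarrow> k = k' \<and> t = t' \<and> a' \<le> a \<and> b \<le> b'"
  using assms by (cases k; cases k') (auto simp: times_subset_iff, (metis atLeastatMost_subset_iff singletonD
      antisym_conv less_irrefl less_imp_le atLeastAtMost_iff order_refl subsetD)+)

lemma axis_segment_Un:
  assumes "axis_segment k t a b \<inter> axis_segment k t' a' b' \<noteq> {}"
  shows "axis_segment k t a b \<union> axis_segment k t' a' b' = axis_segment k t (min a a') (max b b')"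
  using assms by (cases k) auto

lemma is_segment_Un:
  assumes "is_segment k \<gamma>" "is_segment k \<gamma>'" "\<gamma> \<inter> \<gamma>' \<noteq> {}"
  shows "is_segment k (\<gamma> \<union> \<gamma>')"
proof -
  obtain t a b where seg: "a < b" "\<gamma> = axis_segment k t a b"
    using assms(1) by (auto simp: is_segment_def)
  moreover obtain t' a' b' where "\<gamma>' = axis_segment k t' a' b'"
    using assms(2) by (auto simp: is_segment_def)
  ultimately have "\<gamma> \<union> \<gamma>' = axis_segment k t (min a a') (max b b')"
    using axis_segment_Un assms(3) by blast
  moreover have "min a a' < max b b'" using seg(1) by auto
  ultimately show ?thesis unfolding is_segment_def by blast
qed

lemma split_of_mesh_Un:
  assumes "split_of_mesh k M \<gamma>" "split_of_mesh k M \<gamma>'" "\<gamma> \<inter> \<gamma>' \<noteq> {}"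
  shows "split_of_mesh k M (\<gamma> \<union> \<gamma>')"
proof -
  obtain S S' where S: "finite S" "S \<noteq> {}" "\<gamma> = \<Union>S" "S \<subseteq> dir_meshlines k M"
    and S': "finite S'" "\<gamma>' = \<Union>S'" "S' \<subseteq> dir_meshlines k M"
    using assms by (auto simp: split_of_mesh_def)
  have seg: "is_segment k (\<gamma> \<union> \<gamma>')"
    using assms by (intro is_segment_Un) (auto simp: split_of_mesh_def)
  have "finite (S \<union> S') \<and> S \<union> S' \<noteq> {} \<and> \<gamma> \<union> \<gamma>' = \<Union>(S \<union> S') \<and> S \<union> S' \<subseteq> dir_meshlines k M"
    using S S' by auto
  with seg show ?thesis unfolding split_of_mesh_def by (rule conjI[OF _ exI])
qed

lemma dir_meshline_split: "g \<in> dir_meshlines k M \<Longrightarrow> split_of_mesh k M g"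
  unfolding split_of_mesh_def by (intro conjI exI[of _ "{g}"]) (auto simp: dir_meshlines_def)

text \<open>\<open>maximal_split\<close> asks only for collinearity with a meshline; this recovers
  the direction of that meshline.\<close>

lemma is_segment_of_collinear:
  assumes "u \<noteq> v" and "is_segment k \<gamma>" and "collinear (closed_segment u v \<union> \<gamma>)"
  shows "is_segment k (closed_segment u v)"
proof -
  obtain t a b where seg: "a < b" "\<gamma> = axis_segment k t a b"
    using assms(2) by (auto simp: is_segment_def)
  obtain d where d: "\<And>x y. x \<in> closed_segment u v \<union> \<gamma> \<Longrightarrow> y \<in> closed_segment u v \<union> \<gamma> \<Longrightarrow> \<exists>c. x - y = c *\<^sub>R d"
    using assms(3) unfolding collinear_def by blast
  obtain c where c: "u - v = c *\<^sub>R d" using d[of u v] by auto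
  show ?thesis
  proof (cases k)
    case Vertical
    then obtain c' where "(t, b) - (t, a) = c' *\<^sub>R d" using d[of "(t, b)" "(t, a)"] seg by auto
    then have "fst d = 0" using seg(1) by (cases d) auto
    then have "fst u = fst v" using c by (cases u; cases v; cases d) auto
    then have "closed_segment u v = axis_segment k (fst u) (min (snd u) (snd v)) (max (snd u) (snd v))"
      using Vertical closed_segment_same_fst[of u v] by (auto simp: closed_segment_eq_real_ivl)
    moreover have "snd u \<noteq> snd v" using \<open>fst u = fst v\<close> assms(1) by (simp add: prod_eq_iff)
    then have "min (snd u) (snd v) < max (snd u) (snd v)" by auto
    ultimately show ?thesis unfolding is_segment_def by blast
  next
    case Horizontal
    then obtain c' where "(b, t) - (a, t) = c' *\<^sub>R d" using d[of "(b, t)" "(a, t)"] seg by auto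
    then have "snd d = 0" using seg(1) by (cases d) auto
    then have "snd u = snd v" using c by (cases u; cases v; cases d) auto
    then have "closed_segment u v = axis_segment k (snd u) (min (fst u) (fst v)) (max (fst u) (fst v))"
      using Horizontal closed_segment_same_snd[of u v] by (auto simp: closed_segment_eq_real_ivl)
    moreover have "fst u \<noteq> fst v" using \<open>snd u = snd v\<close> assms(1) by (simp add: prod_eq_iff)
    then have "min (fst u) (fst v) < max (fst u) (fst v)" by auto
    ultimately show ?thesis unfolding is_segment_def by blast
  qed
qed

lemma finite_corners: "finite (corners R)"
proof (cases "is_rectangle R")
  case True
  then obtain a b c d where R: "a < b" "c < d" "R = {a..b} \<times> {c..d}" by (auto simp: is_rectangle_def)
  have "corners R \<subseteq> {a, b} \<times> {c, d}"
  proof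
    fix v assume "v \<in> corners R"
    then obtain a' b' c' d' where v: "a' < b'" "c' < d'" "R = {a'..b'} \<times> {c'..d'}" "v \<in> {a', b'} \<times> {c', d'}"
      by (auto simp: corners_def)
    then have "{a..b} = {a'..b'}" "{c..d} = {c'..d'}" using R by (auto simp: times_eq_iff)
    then show "v \<in> {a, b} \<times> {c, d}" using v R by (simp add: Icc_eq_Icc)
  qed
  then show ?thesis by (rule finite_subset) simp
next
  case False
  then have "corners R = {}" by (auto simp: is_rectangle_def corners_def)
  then show ?thesis by simp
qed

lemma finite_meshlines:
  assumes "finite (elements M)"
  shows "finite (meshlines M)"
proof -
  have fin: "finite (mesh_vertices M)"
    unfolding mesh_vertices_def by (intro finite_UN_I assms finite_corners)
  have "meshlines M \<subseteq> (\<lambda>(u, v). closed_segment u v) ` (mesh_vertices M \<times> mesh_vertices M)"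
    unfolding meshlines_def by blast
  then show ?thesis using fin by (meson finite_SigmaI finite_imageI finite_subset)
qed

text \<open>Among the splits containing \<open>\<gamma>\<close>, one with the most meshlines is
  maximal: adjoining a further contiguous collinear meshline would raise the number.\<close>

lemma maximal_split_exists:
  assumes fin: "finite (meshlines M)" and \<gamma>: "split_of_mesh k M \<gamma>"
  shows "\<exists>\<gamma>'. maximal_split k M \<gamma>' \<and> \<gamma> \<subseteq> \<gamma>'"
proof -
  define P where "P \<gamma>' \<longleftrightarrow> split_of_mesh k M \<gamma>' \<and> \<gamma> \<subseteq> \<gamma>'" for \<gamma>'
  define N where "N \<gamma>' = card {g \<in> meshlines M. g \<subseteq> \<gamma>'}" for \<gamma>'
  have "P \<gamma>" using \<gamma> by (simp add: P_def)
  moreover have "N \<gamma>' \<le> card (meshlines M)" for \<gamma>'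
    unfolding N_def by (intro card_mono fin) auto
  ultimately obtain \<gamma>' where \<gamma>': "P \<gamma>'" "\<And>y. P y \<Longrightarrow> N y \<le> N \<gamma>'"
    using ex_has_greatest_nat[of P \<gamma> N "card (meshlines M) + 1"] by (auto simp: less_Suc_eq_le)
  have "g \<subseteq> \<gamma>'" if g: "g \<in> meshlines M" "g \<inter> \<gamma>' \<noteq> {}" "collinear (g \<union> \<gamma>')" for g
  proof (rule ccontr)
    assume "\<not> g \<subseteq> \<gamma>'"
    obtain u v where "u \<noteq> v" "g = closed_segment u v" using g(1) by (auto simp: meshlines_def)
    moreover have "is_segment k \<gamma>'" using \<gamma>'(1) by (simp add: P_def split_of_mesh_def)
    ultimately have "is_segment k g" using is_segment_of_collinear g(3) by blast
    then have "g \<in> dir_meshlines k M" using g(1) by (simp add: dir_meshlines_def)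
    then have "split_of_mesh k M (g \<union> \<gamma>')"
      using split_of_mesh_Un[OF dir_meshline_split] g(2) \<gamma>'(1) by (auto simp: P_def)
    then have "P (g \<union> \<gamma>')" using \<gamma>'(1) by (auto simp: P_def)
    moreover have "N \<gamma>' < N (g \<union> \<gamma>')"
      unfolding N_def
    proof (rule psubset_card_mono)
      show "finite {h \<in> meshlines M. h \<subseteq> g \<union> \<gamma>'}" using fin by simp
      show "{h \<in> meshlines M. h \<subseteq> \<gamma>'} \<subset> {h \<in> meshlines M. h \<subseteq> g \<union> \<gamma>'}"
        using g(1) \<open>\<not> g \<subseteq> \<gamma>'\<close> by auto
    qed
    ultimately show False using \<gamma>'(2) by fastforce
  qed
  then show ?thesis using \<gamma>'(1) unfolding maximal_split_def P_def by blast
qed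

section \<open>Multiplicities of splits\<close>

locale constant_mesh =
  fixes p :: "nat \<times> nat" and M :: box_mesh
  assumes admissible: "admissible_mesh p M" and uniform: "constant_splits M"
begin

text \<open>Constancy is postulated on maximal splits only, so \<open>\<gamma>\<close> is first
  enlarged to one. The meshline \<open>g\<close> then makes the definite description in
  \<open>split_mult\<close> unique.\<close>

lemma split_mult_eq:
  assumes \<gamma>: "split_of_mesh k M \<gamma>" and g: "g \<in> meshlines M" "g \<subseteq> \<gamma>"
  shows "split_mult M \<gamma> = mline_mult M g"
proof -
  have "finite (meshlines M)"
    using admissible by (intro finite_meshlines) (simp add: admissible_mesh_def box_partition_def)
  then obtain \<gamma>' where "maximal_split k M \<gamma>'" "\<gamma> \<subseteq> \<gamma>'" using maximal_split_exists \<gamma> by blast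
  have "\<forall>h\<in>meshlines M. h \<subseteq> \<gamma> \<longrightarrow> mline_mult M h = mline_mult M g"
  proof (intro ballI impI)
    fix h assume "h \<in> meshlines M" "h \<subseteq> \<gamma>"
    with \<open>\<gamma> \<subseteq> \<gamma>'\<close> g show "mline_mult M h = mline_mult M g"
      by (intro uniform[unfolded constant_splits_def, rule_format, OF \<open>maximal_split k M \<gamma>'\<close>]) auto
  qed
  then show ?thesis unfolding split_mult_def
  proof (rule the_equality)
    fix m assume "\<forall>h\<in>meshlines M. h \<subseteq> \<gamma> \<longrightarrow> mline_mult M h = m"
    then show "m = mline_mult M g" using g by simp
  qed
qed

lemma split_contains_meshline:
  assumes "split_of_mesh k M \<gamma>"
  obtains g where "g \<in> dir_meshlines k M" "g \<subseteq> \<gamma>"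
  using assms unfolding split_of_mesh_def by blast

text \<open>Equality holds because the smaller split contains a meshline, which lies in
  both.\<close>

lemma split_mult_mono:
  assumes "split_of_mesh k M \<gamma>" "split_of_mesh k' M \<gamma>'" "\<gamma> \<subseteq> \<gamma>'"
  shows "split_mult M \<gamma> = split_mult M \<gamma>'"
proof -
  obtain g where "g \<in> dir_meshlines k M" "g \<subseteq> \<gamma>" using split_contains_meshline assms(1) by blast
  then have "g \<in> meshlines M" "g \<subseteq> \<gamma>" "g \<subseteq> \<gamma>'" using assms(3) by (auto simp: dir_meshlines_def)
  then show ?thesis using split_mult_eq[OF assms(1)] split_mult_eq[OF assms(2)] by simp
qed

lemma split_mult_le:
  assumes "split_of_mesh k M \<gamma>"
  shows "split_mult M \<gamma> \<le> deg p k + 1"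
proof -
  obtain g where "g \<in> dir_meshlines k M" "g \<subseteq> \<gamma>" using split_contains_meshline assms by blast
  then show ?thesis
    using split_mult_eq[OF assms] admissible by (auto simp: dir_meshlines_def admissible_mesh_def)
qed

end

text \<open>Indexing the knot vectors by direction lets one argument serve vertical and horizontal
  lines.\<close>

fun dir_knots :: "real list \<Rightarrow> real list \<Rightarrow> dir \<Rightarrow> real list" where
  "dir_knots x y Vertical = x"
| "dir_knots x y Horizontal = y"

lemma bspline_splits_iff:
  "(\<sigma>, m) \<in> bspline_splits x y \<longleftrightarrow>
     (\<exists>k. \<exists>t\<in>set (dir_knots x y k).
        \<sigma> = axis_segment k t (hd (dir_knots x y (orth k))) (last (dir_knots x y (orth k))) \<and>
        m = count_list (dir_knots x y k) t)"
  (is "?lhs \<longleftrightarrow> (\<exists>k. ?R k)")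
proof -
  have "?lhs \<longleftrightarrow> ?R Vertical \<or> ?R Horizontal"
    unfolding bspline_splits_def by (simp add: Bex_def conj_commute)
  also have "\<dots> \<longleftrightarrow> (\<exists>k. ?R k)"
  proof
    assume "\<exists>k. ?R k"
    then obtain k where "?R k" by (rule exE)
    then show "?R Vertical \<or> ?R Horizontal" by (cases k) simp_all
  qed (elim disjE; rule exI)
  finally show ?thesis .
qed

text \<open>By the intermediate value property a connected set would have to meet the level set of
  \<open>t\<close>, and that set has been removed. It is applied with the coordinate
  functions.\<close>

lemma not_connected_Diff_line:
  fixes A :: "point set" and f :: "point \<Rightarrow> real"
  assumes "continuous_on A f" "u \<in> A - \<gamma>" "v \<in> A - \<gamma>" "f u < t" "t < f v"
    and "\<And>z. z \<in> A \<Longrightarrow> f z = t \<Longrightarrow> z \<in> \<gamma>"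
  shows "\<not> connected (A - \<gamma>)"
proof
  assume "connected (A - \<gamma>)"
  then have "connected (f ` (A - \<gamma>))"
    using assms(1) by (intro connected_continuous_image continuous_on_subset[OF assms(1)]) auto
  then have "{f u..f v} \<subseteq> f ` (A - \<gamma>)"
    using assms(2,3) by (intro connected_contains_Icc) auto
  then have "t \<in> f ` (A - \<gamma>)" using assms(4,5) by auto
  then show False using assms(6) by auto
qed

lemma split_traverses_bspline:
  assumes "hd (dir_knots x y k) < t" "t < last (dir_knots x y k)"
    and "hd (dir_knots x y (orth k)) < last (dir_knots x y (orth k))"
    and sub: "axis_segment k t (hd (dir_knots x y (orth k))) (last (dir_knots x y (orth k))) \<subseteq> \<gamma>"
    and seg: "\<gamma> = axis_segment k t a b"
  shows "\<gamma> \<inter> interior (bsupport x y) \<noteq> {}" "traverses_bspline \<gamma> x y"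
proof -
  have ab: "a \<le> hd (dir_knots x y (orth k))" "last (dir_knots x y (orth k)) \<le> b"
    using sub axis_segment_subset_iff[OF assms(3)] unfolding seg by blast+
  have int: "interior (bsupport x y) = {hd x<..<last x} \<times> {hd y<..<last y}"
    by (simp add: bsupport_def interior_Times)
  define m where "m = (hd (dir_knots x y (orth k)) + last (dir_knots x y (orth k))) / 2"
  have m: "hd (dir_knots x y (orth k)) < m" "m < last (dir_knots x y (orth k))"
    using assms(3) by (auto simp: m_def)
  obtain s1 s2 where s: "hd (dir_knots x y k) < s1" "s1 < t" "t < s2" "s2 < last (dir_knots x y k)"
    using assms(1,2) by (meson dense)
  show "\<gamma> \<inter> interior (bsupport x y) \<noteq> {}"
  proof (cases k)
    case Vertical
    then have "(t, m) \<in> \<gamma> \<inter> interior (bsupport x y)" using m assms(1,2) sub int by auto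
    then show ?thesis by blast
  next
    case Horizontal
    then have "(m, t) \<in> \<gamma> \<inter> interior (bsupport x y)" using m assms(1,2) sub int by auto
    then show ?thesis by blast
  qed
  show "traverses_bspline \<gamma> x y"
    unfolding traverses_bspline_def
  proof (cases k)
    case Vertical
    show "\<not> connected (interior (bsupport x y) - \<gamma>)"
      by (rule not_connected_Diff_line[of _ fst "(s1, m)" \<gamma> "(s2, m)" t])
        (use Vertical m s ab in \<open>auto simp: int seg intro: continuous_intros\<close>)
  next
    case Horizontal
    show "\<not> connected (interior (bsupport x y) - \<gamma>)"
      by (rule not_connected_Diff_line[of _ snd "(m, s1)" \<gamma> "(m, s2)" t])
        (use Horizontal m s ab in \<open>auto simp: int seg intro: continuous_intros\<close>)
  qed
qed

section \<open>Mesh lines through the support of a B-spline\<close>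

context constant_mesh
begin

lemma has_support_split:
  assumes "has_support p M x y" "t \<in> set (dir_knots x y k)"
  obtains k' \<gamma> where "split_of_mesh k' M \<gamma>"
    "axis_segment k t (hd (dir_knots x y (orth k))) (last (dir_knots x y (orth k))) \<subseteq> \<gamma>"
    "count_list (dir_knots x y k) t \<le> split_mult M \<gamma>"
proof -
  have "(axis_segment k t (hd (dir_knots x y (orth k))) (last (dir_knots x y (orth k))),
      count_list (dir_knots x y k) t) \<in> bspline_splits x y"
    unfolding bspline_splits_iff
    by (rule exI[of _ k], rule bexI[OF _ assms(2)], rule conjI[OF refl refl])
  moreover have "\<forall>(\<sigma>, m)\<in>bspline_splits x y.
      \<exists>k \<gamma>. split_of_mesh k M \<gamma> \<and> \<sigma> \<subseteq> \<gamma> \<and> m \<le> split_mult M \<gamma>"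
    using assms(1) unfolding has_support_def by (elim conjE)
  ultimately show ?thesis using that by fast
qed

lemma length_dir_knots: "has_support p M x y \<Longrightarrow> length (dir_knots x y k) = deg p k + 2"
  by (cases k) (auto simp: has_support_def knot_vectors_def)

lemma sorted_dir_knots: "has_support p M x y \<Longrightarrow> sorted (dir_knots x y k)"
  by (cases k) (auto simp: has_support_def knot_vectors_def)

text \<open>If all knots in direction \<open>k\<close> coincide, their multiplicity is
  \<open>deg p k + 2\<close>. The direction \<open>k'\<close> is kept open because the segment may
  be a single point.\<close>

lemma degenerate_split:
  assumes "has_support p M x y" "hd (dir_knots x y k) = last (dir_knots x y k)"
  obtains k' \<gamma> where "split_of_mesh k' M \<gamma>"
    "axis_segment k (hd (dir_knots x y k)) (hd (dir_knots x y (orth k))) (last (dir_knots x y (orth k))) \<subseteq> \<gamma>"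
    "deg p k + 2 \<le> deg p k' + 1"
proof -
  define v where "v = dir_knots x y k"
  note len = length_dir_knots[OF assms(1), of k, folded v_def]
    and sorted = sorted_dir_knots[OF assms(1), of k, folded v_def]
  have "\<forall>a\<in>set v. a = hd v"
    using sorted_hd_le[OF sorted] sorted_le_last[OF sorted] assms(2) by (force simp: v_def)
  then have "count_list v (hd v) = deg p k + 2"
    using len by (simp add: count_list_eq_length_filter filter_id_conv)
  moreover have "hd v \<in> set v" using len by (cases v) auto
  ultimately obtain k' \<gamma> where "split_of_mesh k' M \<gamma>"
    "axis_segment k (hd v) (hd (dir_knots x y (orth k))) (last (dir_knots x y (orth k))) \<subseteq> \<gamma>"
    "deg p k + 2 \<le> split_mult M \<gamma>"
    using has_support_split[OF assms(1), of "hd v" k] by (metis v_def)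
  then show ?thesis using that split_mult_le[of k' \<gamma>] unfolding v_def by (meson le_trans)
qed

text \<open>A degenerate knot vector in direction \<open>k\<close> has a multiplicity too large for
  lines of direction \<open>k\<close>, so its line lies in an orthogonal one. This makes the other
  knot vector degenerate too and the degree in direction \<open>k\<close> the smaller one.
  Exchanging the directions gives the reverse strict inequality.\<close>

lemma support_nondegenerate:
  assumes "has_support p M x y"
  shows "hd (dir_knots x y k) < last (dir_knots x y k)"
proof (rule ccontr)
  have le: "hd (dir_knots x y k) \<le> last (dir_knots x y k)" for k
    using length_dir_knots[OF assms, of k] sorted_dir_knots[OF assms, of k]
    by (intro sorted_hd_le last_in_set) auto
  have step: "hd (dir_knots x y (orth k)) = last (dir_knots x y (orth k)) \<and> deg p k < deg p (orth k)"
    if eq: "hd (dir_knots x y k) = last (dir_knots x y k)" for k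
  proof -
    obtain k' \<gamma> where k': "split_of_mesh k' M \<gamma>" "deg p k + 2 \<le> deg p k' + 1"
      "axis_segment k (hd (dir_knots x y k)) (hd (dir_knots x y (orth k))) (last (dir_knots x y (orth k))) \<subseteq> \<gamma>"
      using degenerate_split[OF assms eq] by metis
    then have "k' \<noteq> k" by auto
    then have "k' = orth k" by (cases k; cases k') auto
    \<comment> \<open>A nondegenerate segment cannot lie in a segment of the orthogonal
      direction.\<close>
    moreover have "\<not> hd (dir_knots x y (orth k)) < last (dir_knots x y (orth k))"
      using k'(1,3) \<open>k' \<noteq> k\<close> axis_segment_subset_iff
      unfolding split_of_mesh_def is_segment_def by metis
    ultimately show ?thesis using k'(2) le[of "orth k"] by auto
  qed
  have "orth (orth k) = k" by (cases k) auto
  moreover assume "\<not> ?thesis"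
  ultimately show False using step[of k] step[of "orth k"] le[of k] by auto
qed

lemma support_proper_knots:
  assumes "has_support p M x y"
  shows "proper_knots (deg p k) (dir_knots x y k)"
  unfolding proper_knots_def
  using length_dir_knots sorted_dir_knots support_nondegenerate assms by blast

text \<open>Nondegeneracy fixes the direction and the position of the mesh line left open in
  \<open>has_support\<close>.\<close>

lemma support_line:
  assumes "has_support p M x y" "t \<in> set (dir_knots x y k)"
  obtains a b where "split_of_mesh k M (axis_segment k t a b)"
    "a \<le> hd (dir_knots x y (orth k))" "last (dir_knots x y (orth k)) \<le> b"
    "count_list (dir_knots x y k) t \<le> split_mult M (axis_segment k t a b)"
proof -
  obtain k' \<gamma> where \<gamma>: "split_of_mesh k' M \<gamma>"
    "axis_segment k t (hd (dir_knots x y (orth k))) (last (dir_knots x y (orth k))) \<subseteq> \<gamma>"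
    "count_list (dir_knots x y k) t \<le> split_mult M \<gamma>"
    using has_support_split[OF assms] by metis
  obtain t' a b where seg: "\<gamma> = axis_segment k' t' a b"
    using \<gamma>(1) by (auto simp: split_of_mesh_def is_segment_def)
  have "k = k' \<and> t = t' \<and> a \<le> hd (dir_knots x y (orth k)) \<and> last (dir_knots x y (orth k)) \<le> b"
    using \<gamma>(2) support_nondegenerate[OF assms(1), of "orth k"] axis_segment_subset_iff
    unfolding seg by blast
  then show ?thesis using that \<gamma>(1,3) unfolding seg by blast
qed

text \<open>The line traverses the support, so minimality provides a B-spline split of the same
  multiplicity inside it. Being nondegenerate, that split can only be the one at
  \<open>t\<close>.\<close>

lemma minimal_support_line:
  assumes ms: "has_minimal_support p M x y" and line: "split_of_mesh k M (axis_segment k t a b)"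
    and ab: "a \<le> hd (dir_knots x y (orth k))" "last (dir_knots x y (orth k)) \<le> b"
    and t: "hd (dir_knots x y k) < t" "t < last (dir_knots x y k)"
  shows "split_mult M (axis_segment k t a b) = count_list (dir_knots x y k) t"
proof -
  define \<gamma> where "\<gamma> = axis_segment k t a b"
  have supp: "has_support p M x y" using ms by (simp add: has_minimal_support_def)
  note lt = support_nondegenerate[OF supp]
  have sub: "axis_segment k t (hd (dir_knots x y (orth k))) (last (dir_knots x y (orth k))) \<subseteq> \<gamma>"
    using ab lt[of "orth k"] by (simp add: axis_segment_subset_iff \<gamma>_def)
  have "\<gamma> \<inter> interior (bsupport x y) \<noteq> {}" "traverses_bspline \<gamma> x y"
    by (fact split_traverses_bspline[OF t lt sub \<gamma>_def])+
  then obtain \<sigma> where "(\<sigma>, split_mult M \<gamma>) \<in> bspline_splits x y" "\<sigma> \<subseteq> \<gamma>"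
    using ms line unfolding has_minimal_support_def \<gamma>_def by blast
  then obtain k' t' where "axis_segment k' t' (hd (dir_knots x y (orth k'))) (last (dir_knots x y (orth k'))) \<subseteq> \<gamma>"
    "split_mult M \<gamma> = count_list (dir_knots x y k') t'"
    unfolding bspline_splits_iff by blast
  then show ?thesis using lt[of "orth k'"] by (simp add: axis_segment_subset_iff \<gamma>_def)
qed

text \<open>At a knot of \<open>v\<close> inside the range of \<open>b\<close>, the lines of the two
  B-splines overlap or touch and unite to a line across the support of \<open>b\<close>. Minimality
  then bounds the multiplicity in \<open>v\<close> by that in the knot vector of
  \<open>b\<close>.\<close>

lemma joined_lines_knots:
  assumes supp: "has_support p M x y" "has_support p M x' y'" and ms: "has_minimal_support p M xb yb"
    and same: "dir_knots x y k = v" "dir_knots x' y' k = v"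
    and cover: "hd (dir_knots x y (orth k)) \<le> hd (dir_knots xb yb (orth k))"
      "hd (dir_knots x' y' (orth k)) \<le> last (dir_knots x y (orth k))"
      "last (dir_knots xb yb (orth k)) \<le> last (dir_knots x' y' (orth k))"
    and ends: "starts_before (dir_knots xb yb k) v" "ends_after (dir_knots xb yb k) v"
  shows "dir_knots xb yb k = v"
proof -
  define w where "w = dir_knots xb yb k"
  have supp_b: "has_support p M xb yb" using ms by (simp add: has_minimal_support_def)
  have sorted: "sorted v" "sorted w"
    using sorted_dir_knots supp(1) supp_b same(1) unfolding w_def by blast+
  have len: "length v = length w"
    using length_dir_knots[OF supp(1), of k] length_dir_knots[OF supp_b, of k] same(1) by (simp add: w_def)
  have "count_list v t \<le> count_list w t" for t
  proof (cases "t \<in> set v")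
    case False
    then show ?thesis by (simp add: count_notin)
  next
    case True
    have range: "hd v \<le> t" "t \<le> last v" using sorted_hd_le sorted_le_last sorted(1) True by auto
    have le: "hd w \<le> hd v" "last v \<le> last w"
      using ends by (auto simp: starts_before_def ends_after_def w_def)
    \<comment> \<open>At the ends of the range of \<open>b\<close> minimality says nothing; there
      the dominance hypotheses compare the multiplicities.\<close>
    consider "t = hd w" | "t = last w" | "hd w < t" "t < last w" using le range by linarith
    then show ?thesis
    proof cases
      case 1
      then have "hd w = hd v" using le range by simp
      then show ?thesis using 1 ends(1) by (simp add: starts_before_def w_def)
    next
      case 2
      then have "last w = last v" using le range by simp
      then show ?thesis using 2 ends(2) by (simp add: ends_after_def w_def)
    next
      case 3
      obtain a b where ab: "split_of_mesh k M (axis_segment k t a b)"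
        "a \<le> hd (dir_knots x y (orth k))" "last (dir_knots x y (orth k)) \<le> b"
        "count_list v t \<le> split_mult M (axis_segment k t a b)"
        using support_line[OF supp(1), of t k] True same by metis
      obtain a' b' where ab': "split_of_mesh k M (axis_segment k t a' b')"
        "a' \<le> hd (dir_knots x' y' (orth k))" "last (dir_knots x' y' (orth k)) \<le> b'"
        using support_line[OF supp(2), of t k] True same by metis
      have lt: "hd (dir_knots x y (orth k)) < last (dir_knots x y (orth k))"
        "hd (dir_knots x' y' (orth k)) < last (dir_knots x' y' (orth k))"
        "hd (dir_knots xb yb (orth k)) < last (dir_knots xb yb (orth k))"
        by (fact support_nondegenerate[OF supp(1)] support_nondegenerate[OF supp(2)]
            support_nondegenerate[OF supp_b])+
      define \<gamma> where "\<gamma> = axis_segment k t a b \<union> axis_segment k t a' b'"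
      have "max a a' \<le> min b b'" using ab ab' lt cover by simp
      then have meet: "axis_segment k t a b \<inter> axis_segment k t a' b' \<noteq> {}"
        by (cases k) (auto simp: disjoint_iff intro!: exI[of _ "max a a'"])
      have \<gamma>: "\<gamma> = axis_segment k t (min a a') (max b b')"
        unfolding \<gamma>_def by (rule axis_segment_Un[OF meet])
      have split: "split_of_mesh k M \<gamma>"
        unfolding \<gamma>_def by (rule split_of_mesh_Un[OF ab(1) ab'(1) meet])
      have "split_mult M (axis_segment k t a b) = split_mult M \<gamma>"
        by (rule split_mult_mono[OF ab(1) split]) (simp add: \<gamma>_def)
      also have "split_mult M \<gamma> = count_list w t"
        unfolding \<gamma> w_def
        by (rule minimal_support_line[OF ms]) (use split 3 ab ab' cover in \<open>auto simp: \<gamma> w_def\<close>)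
      finally show ?thesis using ab(4) by simp
    qed
  qed
  \<comment> \<open>Equal lengths turn the inclusion of multisets into equality.\<close>
  then have "mset v \<subseteq># mset w" by (simp add: subseteq_mset_def count_mset)
  then have "mset v = mset w"
    using len mset_subset_size[of "mset v" "mset w"] by (auto simp: subset_mset.le_less)
  then have "sort w = v" using sorted(1) by (rule properties_for_sort)
  then show ?thesis using sorted(2) by (simp add: sorted_sort_id w_def)
qed

end

lemma lr_mesh_constant_mesh: "lr_mesh p M \<Longrightarrow> constant_mesh p M"
  by (erule lr_mesh.cases) (simp_all only: constant_mesh_def simp_thms)

section \<open>Dependence relations\<close>

text \<open>
  What minimality of the supports contributes to the argument: the mesh lines of \<open>i\<close> and \<open>j\<close> at
  the common knots \<open>ys i = ys j\<close> join to lines that cross the support of \<open>b\<close>.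
\<close>

definition lines_join :: "('i \<Rightarrow> real list) \<Rightarrow> ('i \<Rightarrow> real list) \<Rightarrow> 'i set \<Rightarrow> bool" where
  "lines_join xs ys J \<longleftrightarrow> (\<forall>i\<in>J. \<forall>j\<in>J. \<forall>b\<in>J.
     ys i = ys j \<and> hd (xs i) \<le> hd (xs b) \<and> hd (xs j) \<le> last (xs i) \<and> last (xs b) \<le> last (xs j) \<and>
     starts_before (ys b) (ys i) \<and> ends_after (ys b) (ys i) \<longrightarrow> ys b = ys i)"

lemma first_startingD:
  assumes "j \<in> first_starting xs J"
  shows "j \<in> J" "i \<in> J \<Longrightarrow> starts_before (xs j) (xs i)" "i \<in> J \<Longrightarrow> hd (xs j) \<le> hd (xs i)"
  using assms unfolding first_starting_def starts_before_def by fastforce+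

lemma last_endingD:
  assumes "j \<in> last_ending xs J"
  shows "j \<in> J" "i \<in> J \<Longrightarrow> ends_after (xs j) (xs i)" "i \<in> J \<Longrightarrow> last (xs i) \<le> last (xs j)"
  using assms unfolding last_ending_def ends_after_def by fastforce+

lemma first_starting_hd_eq:
  assumes "i \<in> first_starting xs J" "j \<in> first_starting xs J"
  shows "hd (xs i) = hd (xs j)"
  using first_startingD(3)[OF assms(1) first_startingD(1)[OF assms(2)]]
    first_startingD(3)[OF assms(2) first_startingD(1)[OF assms(1)]] by simp

lemma last_ending_last_eq:
  assumes "i \<in> last_ending xs J" "j \<in> last_ending xs J"
  shows "last (xs i) = last (xs j)"
  using last_endingD(3)[OF assms(1) last_endingD(1)[OF assms(2)]]
    last_endingD(3)[OF assms(2) last_endingD(1)[OF assms(1)]] by simp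

lemma leading_weightsD:
  assumes "leading_weights J S f w" "\<forall>s. (\<Sum>j\<in>J. c j * f j s) = 0"
  shows "(\<Sum>j\<in>J. c j * w j) = 0"
  using assms unfolding leading_weights_def by auto

text \<open>The mesh enters only through \<open>lines_join\<close>. The assumptions are symmetric in
  the two coordinates.\<close>

locale spline_dependence =
  fixes J :: "'i set" and d1 d2 :: nat and xs ys :: "'i \<Rightarrow> real list" and \<alpha> :: "'i \<Rightarrow> real"
  assumes finite_J: "finite J" and nonempty: "J \<noteq> {}"
    and xs: "\<And>j. j \<in> J \<Longrightarrow> proper_knots d1 (xs j)"
    and ys: "\<And>j. j \<in> J \<Longrightarrow> proper_knots d2 (ys j)"
    and nonzero: "\<And>j. j \<in> J \<Longrightarrow> \<alpha> j \<noteq> 0"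
    and relation: "\<And>s t. (\<Sum>j\<in>J. \<alpha> j * bspline (xs j) s * bspline (ys j) t) = 0"
    and inj: "\<And>i j. i \<in> J \<Longrightarrow> j \<in> J \<Longrightarrow> xs i = xs j \<Longrightarrow> ys i = ys j \<Longrightarrow> i = j"
    and join_x: "lines_join xs ys J"
    and join_y: "lines_join ys xs J"
begin

text \<open>Carries every statement about left and right over to bottom and top.\<close>

lemma swap: "spline_dependence J d2 d1 ys xs \<alpha>"
proof
  show "(\<Sum>j\<in>J. \<alpha> j * bspline (ys j) s * bspline (xs j) t) = 0" for s t
    using relation[of t s] by (simp add: mult.commute mult.left_commute)
qed (use finite_J nonempty xs ys nonzero inj join_x join_y in auto)

lemma range_le: "j \<in> J \<Longrightarrow> hd (xs j) \<le> last (xs j)" "j \<in> J \<Longrightarrow> hd (ys j) \<le> last (ys j)"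
  using proper_knotsD(3)[OF xs] proper_knotsD(3)[OF ys] by (auto intro: less_imp_le)

text \<open>The case of \<open>lines_join\<close> in which a single B-spline \<open>i\<close>
  already spans the support of \<open>b\<close>.\<close>

lemma xs_eqI:
  assumes "i \<in> J" "b \<in> J" "starts_before (xs b) (xs i)" "ends_after (xs b) (xs i)"
    "hd (ys i) \<le> hd (ys b)" "last (ys b) \<le> last (ys i)"
  shows "xs b = xs i"
  using join_y assms range_le(2)[OF assms(1)] unfolding lines_join_def by blast

text \<open>Whichever of the two dominates at the right end also dominates at the left end, so the
  lines of the other force equal \<open>xs\<close>.\<close>

lemma first_starting_inj:
  assumes "i \<in> first_starting xs J" "j \<in> first_starting xs J" "ys i = ys j"
  shows "i = j"
proof -
  have *: "i = j" if "i \<in> first_starting xs J" "j \<in> first_starting xs J" "ys i = ys j"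
    "ends_after (xs i) (xs j)" for i j
    using that xs_eqI[of j i] inj by (auto simp: first_starting_def)
  have "ends_after (xs i) (xs j) \<or> ends_after (xs j) (xs i)" by (auto simp: ends_after_def)
  then show ?thesis using *[of i j] *[of j i] assms by auto
qed

lemma last_ending_inj:
  assumes "i \<in> last_ending xs J" "j \<in> last_ending xs J" "ys i = ys j"
  shows "i = j"
proof -
  have *: "i = j" if "i \<in> last_ending xs J" "j \<in> last_ending xs J" "ys i = ys j"
    "starts_before (xs i) (xs j)" for i j
    using that xs_eqI[of j i] inj by (auto simp: last_ending_def)
  have "starts_before (xs i) (xs j) \<or> starts_before (xs j) (xs i)" by (auto simp: starts_before_def)
  then show ?thesis using *[of i j] *[of j i] assms by auto
qed

section \<open>Relations between leading terms\<close>

lemma leading_relation: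
  assumes "leading_weights J S (\<lambda>j. bspline (xs j)) w"
  shows "(\<Sum>j\<in>J. \<alpha> j * w j * bspline (ys j) t) = 0"
proof -
  have "\<forall>s. (\<Sum>j\<in>J. (\<alpha> j * bspline (ys j) t) * bspline (xs j) s) = 0"
    using relation[of _ t] by (simp add: mult_ac)
  then have "(\<Sum>j\<in>J. (\<alpha> j * bspline (ys j) t) * w j) = 0"
    by (rule leading_weightsD[OF assms])
  then show ?thesis by (simp add: mult_ac)
qed

text \<open>One term would make a B-spline vanish identically. Two terms would make two B-splines
  proportional, hence equal in their knots.\<close>

lemma leading_class_card:
  assumes w: "leading_weights J S (\<lambda>j. bspline (xs j)) w" and "S \<subseteq> J" "S \<noteq> {}"
    and inj: "\<And>i j. i \<in> S \<Longrightarrow> j \<in> S \<Longrightarrow> ys i = ys j \<Longrightarrow> i = j"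
  shows "3 \<le> card S"
proof (rule ccontr)
  assume "\<not> ?thesis"
  moreover have "finite S" using assms(2) finite_J by (rule finite_subset)
  ultimately have card: "card S = 1 \<or> card S = 2"
    using \<open>S \<noteq> {}\<close> card_gt_0_iff[of S] by linarith
  have w_S: "\<alpha> j * w j \<noteq> 0" if "j \<in> S" for j
    using w nonzero[of j] that assms(2) unfolding leading_weights_def by force
  have sum: "(\<Sum>j\<in>S. \<alpha> j * w j * bspline (ys j) t) = 0" for t
  proof -
    have "(\<Sum>j\<in>S. \<alpha> j * w j * bspline (ys j) t) = (\<Sum>j\<in>J. \<alpha> j * w j * bspline (ys j) t)"
      using w assms(2) finite_J by (intro sum.mono_neutral_left) (auto simp: leading_weights_def)
    then show ?thesis by (simp add: leading_relation[OF w])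
  qed
  from card show False
  proof
    assume "card S = 1"
    then obtain i where i: "S = {i}" by (rule card_1_singletonE)
    obtain t where "bspline (ys i) t \<noteq> 0" using bspline_nonzero[OF ys] i assms(2) by blast
    then show False using sum[of t] w_S[of i] i by simp
  next
    assume "card S = 2"
    then obtain i j where ij: "S = {i, j}" "i \<noteq> j" by (auto simp: card_2_iff)
    have "bspline (ys i) t = - (\<alpha> j * w j) / (\<alpha> i * w i) * bspline (ys j) t" for t
      using sum[of t] w_S[of i] ij by (simp add: field_simps)
    then have "ys i = ys j"
      by (rule bspline_proportional_imp_eq[OF ys ys, rotated 2]) (use ij assms(2) in auto)
    then show False using inj[of i j] ij by auto
  qed
qed

text \<open>Leading terms are taken in both variables in turn. Only members of both classes
  contribute to the resulting sum, and \<open>b\<close> alone would leave a nonzero term.\<close>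

lemma corner_partner:
  assumes w: "leading_weights J S (\<lambda>j. bspline (xs j)) w"
    and v: "leading_weights J T (\<lambda>j. bspline (ys j)) v"
    and b: "b \<in> S \<inter> T" "b \<in> J"
  obtains j where "j \<in> J" "j \<in> S" "j \<in> T" "j \<noteq> b"
proof (rule ccontr)
  assume "\<not> thesis"
  with that have others: "w j * v j = 0" if "j \<in> J - {b}" for j
    using w v \<open>j \<in> J - {b}\<close> unfolding leading_weights_def by (metis DiffD1 DiffD2 DiffI mult_eq_0_iff singletonI)
  have "(\<Sum>j\<in>J. \<alpha> j * w j * v j) = 0"
    using leading_relation[OF w] by (intro leading_weightsD[OF v]) blast
  moreover have "(\<Sum>j\<in>J. \<alpha> j * w j * v j) = \<alpha> b * w b * v b"
  proof -
    have "(\<Sum>j\<in>J - {b}. \<alpha> j * w j * v j) = 0"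
      by (intro sum.neutral ballI) (simp only: others mult.assoc mult_zero_right)
    then show ?thesis using finite_J b(2) by (simp add: sum.remove)
  qed
  moreover have "w b > 0" "v b > 0" using w v b by (auto simp: leading_weights_def)
  ultimately show False using nonzero[OF b(2)] by simp
qed

text \<open>The nonzero weights of a three-element class allow solving the leading relation for
  \<open>b\<close>.\<close>

lemma three_term:
  assumes w: "leading_weights J S (\<lambda>j. bspline (xs j)) w"
    and S: "S = {b, i, k}" "S \<subseteq> J" "b \<noteq> i" "b \<noteq> k" "i \<noteq> k"
  obtains \<beta> \<gamma> where "\<beta> \<noteq> 0" "\<gamma> \<noteq> 0"
    "\<And>t. bspline (ys b) t = \<beta> * bspline (ys i) t + \<gamma> * bspline (ys k) t"
proof
  define c where "c j = \<alpha> j * w j" for j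
  have c: "c j \<noteq> 0" if "j \<in> S" for j
    using w nonzero[of j] that S(2) unfolding leading_weights_def c_def by force
  then show "- c i / c b \<noteq> 0" "- c k / c b \<noteq> 0" using S by auto
  fix t
  have "(\<Sum>j\<in>S. c j * bspline (ys j) t) = (\<Sum>j\<in>J. \<alpha> j * w j * bspline (ys j) t)"
    unfolding c_def
    using w S(2) finite_J by (intro sum.mono_neutral_left) (auto simp: leading_weights_def)
  then have "(\<Sum>j\<in>S. c j * bspline (ys j) t) = 0" by (simp add: leading_relation[OF w])
  then have "c b * bspline (ys b) t = - (c i * bspline (ys i) t) - c k * bspline (ys k) t"
    using S by simp
  moreover have "c b \<noteq> 0" using c S by simp
  ultimately show "bspline (ys b) t = - c i / c b * bspline (ys i) t + - c k / c b * bspline (ys k) t"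
    by (simp add: field_simps)
qed

text \<open>The vertical lines of \<open>j\<close> run from bottom to top and hence across the
  support of \<open>i\<close>, while \<open>i\<close> dominates at both horizontal ends.\<close>

lemma full_extent_xs:
  assumes "i \<in> first_starting xs J" "i \<in> last_ending xs J"
    and "j \<in> first_starting ys J" "j \<in> last_ending ys J"
  shows "xs i = xs j"
proof -
  have J: "i \<in> J" "j \<in> J" using assms first_startingD(1) by metis+
  show ?thesis
    by (rule xs_eqI[OF J(2,1)]) (fact first_startingD(2)[OF assms(1) J(2)]
      last_endingD(2)[OF assms(2) J(2)] first_startingD(3)[OF assms(3) J(1)]
      last_endingD(3)[OF assms(4) J(1)])+
qed

lemma full_extent_unique:
  assumes "i \<in> first_starting xs J" "i \<in> last_ending xs J"
    and "j \<in> first_starting ys J" "j \<in> last_ending ys J"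
  shows "i = j"
proof (rule inj)
  show "xs i = xs j" by (rule full_extent_xs[OF assms])
  show "ys i = ys j"
    using spline_dependence.full_extent_xs[OF swap assms(3,4,1,2)] by simp
qed (use assms in \<open>auto simp: first_starting_def\<close>)

text \<open>The joined lines would give \<open>b\<close> the same \<open>ys\<close> as
  \<open>i\<close>; both are left, so \<open>first_starting_inj\<close> identifies them.\<close>

lemma no_joined_lines:
  assumes b: "b \<in> first_starting xs J" "b \<in> first_starting ys J" "b \<in> last_ending ys J"
    and i: "i \<in> first_starting xs J" and j: "j \<in> last_ending xs J"
    and "ys i = ys j" "hd (xs j) \<le> last (xs i)" "i \<noteq> b"
  shows False
proof -
  have J: "i \<in> J" "j \<in> J" "b \<in> J"
    by (fact first_startingD(1)[OF i] last_endingD(1)[OF j] first_startingD(1)[OF b(1)])+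
  have "ys b = ys i"
    by (rule join_x[unfolded lines_join_def, rule_format, OF J], intro conjI)
      (fact assms(6,7) first_startingD(2)[OF b(2) J(1)] last_endingD(2)[OF b(3) J(1)]
        first_startingD(3)[OF i J(3)] last_endingD(3)[OF j J(3)])+
  then show False using first_starting_inj[OF b(1) i] assms by simp
qed

lemma card_ge_6: "6 \<le> card J"
proof (rule ccontr)
  assume small: "\<not> 6 \<le> card J"
  interpret swap: spline_dependence J d2 d1 ys xs \<alpha> by (rule swap)
  define L R D U where "L = first_starting xs J" and "R = last_ending xs J"
    and "D = first_starting ys J" and "U = last_ending ys J"
  have sub: "L \<subseteq> J" "R \<subseteq> J" "D \<subseteq> J" "U \<subseteq> J"
    by (auto simp: L_def R_def D_def U_def first_starting_def last_ending_def)
  obtain wL where wL: "leading_weights J L (\<lambda>j. bspline (xs j)) wL"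
    using start_weights[of J d1 xs, OF finite_J xs] unfolding L_def by blast
  obtain wR where wR: "leading_weights J R (\<lambda>j. bspline (xs j)) wR"
    using end_weights[of J d1 xs, OF finite_J xs] unfolding R_def by blast
  obtain wD where wD: "leading_weights J D (\<lambda>j. bspline (ys j)) wD"
    using start_weights[of J d2 ys, OF finite_J ys] unfolding D_def by blast
  obtain wU where wU: "leading_weights J U (\<lambda>j. bspline (ys j)) wU"
    using end_weights[of J d2 ys, OF finite_J ys] unfolding U_def by blast
  note w = wL wR wD wU
  have cards: "3 \<le> card L" "3 \<le> card R" "3 \<le> card D" "3 \<le> card U"
    using leading_class_card[OF w(1) sub(1) first_starting_nonempty[OF finite_J nonempty, of xs, folded L_def]
        first_starting_inj[folded L_def]]
      leading_class_card[OF w(2) sub(2) last_ending_nonempty[OF finite_J nonempty, of xs, folded R_def]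
        last_ending_inj[folded R_def]]
      swap.leading_class_card[OF w(3) sub(3) first_starting_nonempty[OF finite_J nonempty, of ys, folded D_def]
        swap.first_starting_inj[folded D_def]]
      swap.leading_class_card[OF w(4) sub(4) last_ending_nonempty[OF finite_J nonempty, of ys, folded U_def]
        swap.last_ending_inj[folded U_def]]
    by (simp_all only:)
  \<comment> \<open>Two disjoint classes of three would need six elements.\<close>
  have meet: "A \<inter> B \<noteq> {}" if "3 \<le> card A" "3 \<le> card B" "A \<subseteq> J" "B \<subseteq> J" for A B
  proof
    assume "A \<inter> B = {}"
    then have "card (A \<union> B) = card A + card B"
      using that finite_J by (intro card_Un_disjoint) (auto intro: finite_subset)
    moreover have "card (A \<union> B) \<le> card J" using that finite_J by (intro card_mono) auto
    ultimately show False using small that by simp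
  qed
  have unique: "i = j" if "i \<in> L" "i \<in> R" "j \<in> D" "j \<in> U" for i j
    using full_extent_unique that unfolding L_def R_def D_def U_def by blast
  from meet[OF cards(1,2) sub(1,2)] meet[OF cards(3,4) sub(3,4)]
  obtain b b' where "b \<in> L" "b \<in> R" "b' \<in> D" "b' \<in> U" by blast
  with unique have b: "b \<in> L" "b \<in> R" "b \<in> D" "b \<in> U" by blast+
  have bJ: "b \<in> J" using b sub by blast
  obtain l1 where l1: "l1 \<in> J" "l1 \<in> L" "l1 \<in> D" "l1 \<noteq> b"
    using corner_partner[OF w(1) w(3)] b bJ by blast
  obtain l2 where l2: "l2 \<in> J" "l2 \<in> L" "l2 \<in> U" "l2 \<noteq> b"
    using corner_partner[OF w(1) w(4)] b bJ by blast
  obtain r1 where r1: "r1 \<in> J" "r1 \<in> R" "r1 \<in> D" "r1 \<noteq> b"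
    using corner_partner[OF w(2) w(3)] b bJ by blast
  obtain r2 where r2: "r2 \<in> J" "r2 \<in> R" "r2 \<in> U" "r2 \<noteq> b"
    using corner_partner[OF w(2) w(4)] b bJ by blast
  \<comment> \<open>Compared with \<open>b\<close>, which belongs to all four classes, any B-spline
    spanning one coordinate direction is \<open>b\<close> itself. Hence the four corner partners are
    distinct and exhaust \<open>J\<close> together with \<open>b\<close>.\<close>
  have only_b: "j = b" if "j \<in> L \<and> j \<in> R \<or> j \<in> D \<and> j \<in> U" for j
    using that unique b by blast
  have distinct: "l1 \<noteq> l2" "r1 \<noteq> r2" "l1 \<noteq> r1" "l1 \<noteq> r2" "l2 \<noteq> r1" "l2 \<noteq> r2"
    using only_b l1 l2 r1 r2 by blast+
  have "card {b, l1, l2, r1, r2} = 5"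
    using distinct l1(4) l2(4) r1(4) r2(4) by auto
  moreover have "{b, l1, l2, r1, r2} \<subseteq> J" using bJ l1(1) l2(1) r1(1) r2(1) by simp
  ultimately have J: "J = {b, l1, l2, r1, r2}"
    using small by (intro card_seteq[OF finite_J, symmetric]) simp_all
  have notin: "l1 \<notin> R" "l2 \<notin> R" "r1 \<notin> L" "r2 \<notin> L" "l1 \<notin> U" "r1 \<notin> U" "l2 \<notin> D" "r2 \<notin> D"
    using only_b l1 l2 r1 r2 by blast+
  have L: "L = {b, l1, l2}" and D: "D = {b, l1, r1}" and U: "U = {b, l2, r2}"
    using sub J b l1 l2 r1 r2 notin by blast+
  obtain \<beta>1 \<beta>2 where "\<beta>1 \<noteq> 0" "\<beta>2 \<noteq> 0"
    and by_eq: "\<And>t. bspline (ys b) t = \<beta>1 * bspline (ys l1) t + \<beta>2 * bspline (ys l2) t"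
    by (rule three_term[OF w(1) L sub(1) l1(4)[symmetric] l2(4)[symmetric] distinct(1)]) (rule that)
  obtain \<gamma>1 \<gamma>2 where \<gamma>: "\<gamma>1 \<noteq> 0" "\<gamma>2 \<noteq> 0"
    and bx_eq: "\<And>s. bspline (xs b) s = \<gamma>1 * bspline (xs l1) s + \<gamma>2 * bspline (xs r1) s"
    by (rule swap.three_term[OF w(3) D sub(3) l1(4)[symmetric] r1(4)[symmetric] distinct(3)]) (rule that)
  obtain \<delta>1 \<delta>2 where \<delta>: "\<delta>1 \<noteq> 0" "\<delta>2 \<noteq> 0"
    and bx_eq': "\<And>s. bspline (xs b) s = \<delta>1 * bspline (xs l2) s + \<delta>2 * bspline (xs r2) s"
    by (rule swap.three_term[OF w(4) U sub(4) l2(4)[symmetric] r2(4)[symmetric] distinct(6)]) (rule that)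
  note hd_eq = first_starting_hd_eq[of _ xs J, folded L_def]
    and last_eq = last_ending_last_eq[of _ xs J, folded R_def]
    and hd_eq' = first_starting_hd_eq[of _ ys J, folded D_def]
    and last_eq' = last_ending_last_eq[of _ ys J, folded U_def]
  \<comment> \<open>In the bottom relation \<open>xs b\<close> starts with \<open>xs l1\<close> and
    ends with \<open>xs r1\<close>, so no gap is possible. The left relation is used likewise for
    \<open>touch_y\<close>.\<close>
  have touch_x: "hd (xs r1) \<le> last (xs l1)"
    by (rule bspline_ranges_touch[OF xs[OF bJ] xs[OF l1(1)] xs[OF r1(1)] bx_eq
          hd_eq[OF b(1) l1(2)] last_eq[OF b(2) r1(2)]])
  have touch_y: "hd (ys l2) \<le> last (ys l1)"
    by (rule bspline_ranges_touch[OF ys[OF bJ] ys[OF l1(1)] ys[OF l2(1)] by_eq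
          hd_eq'[OF b(3) l1(3)] last_eq'[OF b(4) l2(3)]])
  \<comment> \<open>The bottom and top relations eliminate \<open>xs r1\<close> and
    \<open>xs r2\<close> from the dependence; \<open>u\<close>, \<open>v\<close> and
    \<open>v'\<close> collect the coefficients of \<open>xs b\<close>, \<open>xs l1\<close> and
    \<open>xs l2\<close>.\<close>
  define u where "u t = \<alpha> b * bspline (ys b) t + \<alpha> r1 / \<gamma>2 * bspline (ys r1) t
    + \<alpha> r2 / \<delta>2 * bspline (ys r2) t" for t
  define v where "v t = \<alpha> l1 * bspline (ys l1) t - \<alpha> r1 * \<gamma>1 / \<gamma>2 * bspline (ys r1) t" for t
  define v' where "v' t = \<alpha> l2 * bspline (ys l2) t - \<alpha> r2 * \<delta>1 / \<delta>2 * bspline (ys r2) t" for t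
  have rel: "u t * bspline (xs b) s + v t * bspline (xs l1) s + v' t * bspline (xs l2) s = 0" for s t
  proof -
    have r1_eq: "bspline (xs r1) s = (bspline (xs b) s - \<gamma>1 * bspline (xs l1) s) / \<gamma>2"
      using bx_eq[of s] \<gamma> by (simp add: field_simps)
    have r2_eq: "bspline (xs r2) s = (bspline (xs b) s - \<delta>1 * bspline (xs l2) s) / \<delta>2"
      using bx_eq'[of s] \<delta> by (simp add: field_simps)
    have "0 = \<alpha> b * bspline (xs b) s * bspline (ys b) t + \<alpha> l1 * bspline (xs l1) s * bspline (ys l1) t
      + \<alpha> l2 * bspline (xs l2) s * bspline (ys l2) t + \<alpha> r1 * bspline (xs r1) s * bspline (ys r1) t
      + \<alpha> r2 * bspline (xs r2) s * bspline (ys r2) t"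
      using relation[of s t] distinct l1(4) l2(4) r1(4) r2(4) unfolding J by simp
    also have "\<dots> = u t * bspline (xs b) s + v t * bspline (xs l1) s + v' t * bspline (xs l2) s"
      unfolding r1_eq r2_eq u_def v_def v'_def by (simp add: algebra_simps diff_divide_distrib)
    finally show ?thesis by simp
  qed
  have u0: "u t = 0" for t
  proof -
    \<comment> \<open>Padding with zero at \<open>r1\<close> and \<open>r2\<close> makes the weights
      at the right end applicable. There \<open>l1\<close> and \<open>l2\<close> have weight zero,
      so only the term of \<open>b\<close> survives.\<close>
    define c where "c j = (if j = b then u t else if j = l1 then v t else if j = l2 then v' t else 0)" for j
    have "(\<Sum>j\<in>J. c j * bspline (xs j) s) = 0" for s
      using rel[of t s] distinct l1(4) l2(4) r1(4) r2(4) unfolding J by (simp add: c_def)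
    then have "(\<Sum>j\<in>J. c j * wR j) = 0" by (intro leading_weightsD[OF w(2)]) blast
    moreover have "wR l1 = 0" "wR l2 = 0" "wR b > 0"
      using w(2) notin b l1 l2 unfolding leading_weights_def by blast+
    ultimately show ?thesis
      using distinct l1(4) l2(4) r1(4) r2(4) unfolding J by (simp add: c_def)
  qed
  show False
  \<comment> \<open>If \<open>v\<close> vanishes, \<open>ys l1\<close> and \<open>ys r1\<close> are
    proportional and the bottom pair has joined lines. Otherwise a fixed \<open>t\<close> with
    \<open>v t\<close> nonzero makes \<open>xs l1\<close> and \<open>xs l2\<close> proportional, and
    the left pair does.\<close>
  proof (cases "\<forall>t. v t = 0")
    case True
    have "bspline (ys l1) t = \<alpha> r1 * \<gamma>1 / \<gamma>2 / \<alpha> l1 * bspline (ys r1) t" for t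
      using True[rule_format, of t] nonzero[OF l1(1)] \<gamma> by (simp add: v_def field_simps)
    then have "ys l1 = ys r1" by (rule bspline_proportional_imp_eq[OF ys[OF l1(1)] ys[OF r1(1)]])
    then show False
      using no_joined_lines[of b l1 r1] touch_x b l1 r1 unfolding L_def R_def D_def U_def by blast
  next
    case False
    then obtain t where "v t \<noteq> 0" by blast
    then have "bspline (xs l1) s = - v' t / v t * bspline (xs l2) s" for s
      using rel[of t s] u0[of t] by (simp add: field_simps)
    then have "xs l1 = xs l2" by (rule bspline_proportional_imp_eq[OF xs[OF l1(1)] xs[OF l2(1)]])
    then show False
      using swap.no_joined_lines[of b l1 l2] touch_y b l1 l2 unfolding L_def R_def D_def U_def by blast
  qed
qed

end

section \<open>The bound for minimal support B-splines on LR-meshes\<close>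

theorem proposition7p14:
  fixes p :: "nat \<times> nat" and M :: box_mesh
    and n :: nat and B :: "nat \<Rightarrow> real \<times> real \<Rightarrow> real" and \<alpha> :: "nat \<Rightarrow> real"
  assumes "p \<noteq> (0, 0)"
    and "lr_mesh p M"
    and "1 \<le> n"
    and "\<And>j. j \<in> {1..n} \<Longrightarrow> B j \<in> ms_bsplines p M"
    and "inj_on B {1..n}"
    and "\<And>j. j \<in> {1..n} \<Longrightarrow> \<alpha> j \<noteq> 0"
    and "\<And>z. (\<Sum>j=1..n. \<alpha> j * B j z) = 0"
  shows "6 \<le> n"
proof -
  have "\<forall>j\<in>{1..n}. \<exists>x y. B j = bspline2 x y \<and> has_minimal_support p M x y"
    using assms(4) unfolding ms_bsplines_def by blast
  then obtain xs ys where B: "\<And>j. j \<in> {1..n} \<Longrightarrow> B j = bspline2 (xs j) (ys j)"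
    and ms: "\<And>j. j \<in> {1..n} \<Longrightarrow> has_minimal_support p M (xs j) (ys j)"
    by metis
  interpret constant_mesh p M by (rule lr_mesh_constant_mesh) fact
  have supp: "has_support p M (xs j) (ys j)" if "j \<in> {1..n}" for j
    using ms[OF that] by (simp add: has_minimal_support_def)
  have "spline_dependence {1..n} (fst p) (snd p) xs ys \<alpha>"
  proof
    show "finite {1..n}" "{1..n} \<noteq> {}" using assms(3) by auto
    show "proper_knots (fst p) (xs j)" "proper_knots (snd p) (ys j)" if "j \<in> {1..n}" for j
      using support_proper_knots[OF supp[OF that], of Vertical]
        support_proper_knots[OF supp[OF that], of Horizontal] by simp_all
    show "\<alpha> j \<noteq> 0" if "j \<in> {1..n}" for j by (rule assms(6)[OF that])
    show "(\<Sum>j\<in>{1..n}. \<alpha> j * bspline (xs j) s * bspline (ys j) t) = 0" for s t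
    proof -
      have "(\<Sum>j\<in>{1..n}. \<alpha> j * bspline (xs j) s * bspline (ys j) t) = (\<Sum>j=1..n. \<alpha> j * B j (s, t))"
        by (rule sum.cong) (simp_all add: B bspline2_def)
      then show ?thesis by (simp only: assms(7))
    qed
    \<comment> \<open>Equal knot vectors give equal functions, and these are assumed
      distinct.\<close>
    show "i = j" if "i \<in> {1..n}" "j \<in> {1..n}" "xs i = xs j" "ys i = ys j" for i j
      using inj_onD[OF assms(5) _ that(1,2)] B[OF that(1)] B[OF that(2)] that(3,4) by simp
    show "lines_join xs ys {1..n}"
      unfolding lines_join_def
    proof (intro ballI impI, elim conjE)
      fix i j b assume *: "i \<in> {1..n}" "j \<in> {1..n}" "b \<in> {1..n}" "ys i = ys j"
        "hd (xs i) \<le> hd (xs b)" "hd (xs j) \<le> last (xs i)" "last (xs b) \<le> last (xs j)"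
        "starts_before (ys b) (ys i)" "ends_after (ys b) (ys i)"
      show "ys b = ys i"
        using joined_lines_knots[OF supp[OF *(1)] supp[OF *(2)] ms[OF *(3)], of Horizontal "ys i"] *(4-9)
        by simp
    qed
    show "lines_join ys xs {1..n}"
      unfolding lines_join_def
    proof (intro ballI impI, elim conjE)
      fix i j b assume *: "i \<in> {1..n}" "j \<in> {1..n}" "b \<in> {1..n}" "xs i = xs j"
        "hd (ys i) \<le> hd (ys b)" "hd (ys j) \<le> last (ys i)" "last (ys b) \<le> last (ys j)"
        "starts_before (xs b) (xs i)" "ends_after (xs b) (xs i)"
      show "xs b = xs i"
        using joined_lines_knots[OF supp[OF *(1)] supp[OF *(2)] ms[OF *(3)], of Vertical "xs i"] *(4-9)
        by simp
    qed
  qed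
  from spline_dependence.card_ge_6[OF this] show ?thesis by simp
qed

end
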